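(* Let $n\ge 2$ and let $H=H_{\mathbb C}(\widetilde{\mathsf C}_n,D,\Omega)$ be the string algebra of type $\widetilde{\mathsf C}_n$ with minimal symmetrizer $D=\operatorname{diag}(2,1,\ldots,1,2)$ and arbitrary orientation $\Omega$. Let $\underline{\mathrm{rk}}\colon \mathrm{St}_{\mathrm{lf}}(H)\to\mathbb N^I$ be the rank function on locally free strings. Then: (a) The image of $\underline{\mathrm{rk}}$ is the set $\Delta^+(\widetilde{\mathsf C}_n)$ of positive roots of the affine root system of type $\widetilde{\mathsf C}_n$. (b) For each $\mathbf w\in \mathrm{St}_{\mathrm{lf}}(H)$ such that $\underline{\mathrm{rk}}(\mathbf w)\in\Delta^+_{\mathrm{re}}(\widetilde{\mathsf C}_n)$ one has $$\underline{\mathrm{rk}}^{-1}(\underline{\mathrm{rk}}(\mathbf w))=[\mathbf w]\cup[\mathbf w^{-1}].$$ Moreover, in this situation $[\mathbf w]=[\mathbf w^{-1}]$ if and only if $\underline{\mathrm{rk}}(\mathbf w)$ is a long root. (c) For each $\mathbf w\in \mathrm{St}_{\mathrm{lf}}(H)$ such that $\underline{\mathrm{rk}}(\mathbf w)\in\Delta^+_{\mathrm{im}}(\widetilde{\mathsf C}_n)=\mathbb Z_{\ge1}\rho$ one has, for some $k\in\mathbb Z_{\ge 1}$, the disjoint union decomposition $$\underline{\mathrm{rk}}^{-1}(\underline{\mathrm{rk}}(\mathbf w))=\coprod_{i\in I'}\Big([\mathbf r_i[nk-1]]\ \textstyle\coprod\ [\mathbf r_i[nk-1]^{-1}]\Bi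g).$$
   Context: **Algebra.** $n\ge2$, $I=\{0,\ldots,n\}$, $I'=\{1,\ldots,n\}$, $\mathbb N=\{0,1,2,\dots\}$. An orientation is $\Omega=\{(i_1,i_1'),\ldots,(i_n,i_n')\}$ with $\{i_k,i_k'\}=\{k-1,k\}$. $Q$ is the quiver with vertices $I$, loops $\varepsilon_0$ at $0$, $\varepsilon_n$ at $n$, and arrows $\eta_k\colon i'_k\to i_k$ ($1\le k\le n$); $H=\mathbb CQ/(\varepsilon_0^2,\varepsilon_n^2)$. **Roots.** The Cartan matrix $C=(c_{ij})_{i,j\in I}$ of type $\widetilde{\mathsf C}_n$ has $c_{ii}=2$, $c_{01}=c_{n,n-1}=-1$, $c_{10}=c_{n-1,n}=-2$, $c_{k,k+1}=c_{k+1,k}=-1$ for $1\le k\le n-2$, other entries $0$; $D=\operatorname{diag}(2,1,\ldots,1,2)$. The simple roots $\alpha_i$ are identified with the coordinate basis of $\mathbb Z^I$, so $\Delta^+(\widetilde{\mathsf C}_n)\subset\mathbb N^I$ is the set of positive roots of the Kac–Moody algebra of $C$, the disjoint union of the real roots $\Delta^+_{\mathrm{re}}$ and the imaginary roots $\Delta^+_{\mathrm{im}}=\mathbb Z_{\ge1}\rho$, $\rho=(1,2,2,\ldots,2,1)$. Explicitly, with $\alpha_{ij}=\sum_{k=i}^j\alpha_k$ ($1\le i\le j\le n$) and $\beta_{ij}=\alpha_{in}+\alpha_{j,n-1}$ ($1\le i\le j\le n-1$), $\Delta^+_{\mathrm{re}}$ consists of all $k\rho+\alpha_{ij}$, $k\rho+\beta_{ij}$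 ($k\ge0$) and $k\rho-\alpha_{ij}$, $k\rho-\beta_{ij}$ ($k\ge1$). A real root $\beta$ is long if $\beta^tDC\beta=4$ (otherwise this value is $2$ and $\beta$ is short). **Strings.** Letters are the arrows of $Q$ (direct letters) and their formal inverses (inverse letters), with $s(\beta^{-1})=t(\beta)$, $t(\beta^{-1})=s(\beta)$. Strings are the trivial strings $\mathbb 1_i^{\pm1}$ ($i\in I$, $s=t=i$, inverse to each other) and words $w_1\cdots w_l$ in letters with $s(w_{j-1})=t(w_j)$ and $w_{j-1}\ne w_j^{\pm1}$ for $2\le j\le l$; $s(\mathbf w)=s(w_l)$, $t(\mathbf w)=t(w_1)$, $\mathbf w^{-1}=w_l^{-1}\cdots w_1^{-1}$. A string is direct (inverse) if it is trivial or has only direct (only inverse) letters. Concatenation with trivial strings: for $1\le i\le n-1$, $\mathbb 1_i$ can be followed only by $\eta_{i+1}^{\pm1}$ and preceded only by $\eta_i^{\pm1}$, while $\mathbb 1_i^{-1}$ can be followed only by $\eta_i^{\pm1}$ and preceded only by $\eta_{i+1}^{\pm1}$ (with the exponent for which start and end points match); the trivial string is then dropped from the product. A string $\mathbf w$ is locally free if $s(\mathbf w)\in\{0,n\}$ implies that its last letter is $\varepsilon_{s(\mathbf w)}^{\pm1}$ and $t(\mathbf w)\in\{0,n\}$ implies that its first letter is $\varepsilon_{t(\mathbf w)}^{\pm1}$; $\mathbb 1_i^{\pm1}$ is locally free exactly for $1\le i\le n-1$. $\mathrm{St}_{\mathrm{lf}}(H)$ is the set of locally free strings. For a string $\mathbf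 w$ of length $l$ consider the sequence of $l+1$ vertices $t(w_1),t(w_2),\ldots,t(w_l),s(w_l)$ (just $i$ for $\mathbb 1_i^{\pm1}$); for $\mathbf w\in \mathrm{St}_{\mathrm{lf}}(H)$, $\underline{\mathrm{rk}}(\mathbf w)_i$ is the number of occurrences of $i$ in it if $1\le i\le n-1$, and half that number if $i\in\{0,n\}$. **Similarity.** Two strings are similar if they have equal length and agree letter by letter up to replacing some letters $\varepsilon_0^{\pm1},\varepsilon_n^{\pm1}$ by their inverses (a trivial string is similar only to itself). $[\mathbf w]$ is the similarity class of $\mathbf w$. **The strings $\mathbf r_i[k]$.** For $i\in I'$, $\mathbf r_i$ is the longest inverse string such that $\eta_i\mathbf r_i$ is a string (possibly trivial). Each locally free string $\mathbf w$ has a unique pair $(s'(\mathbf w),s''(\mathbf w))\in I'\times\{\pm1\}$ such that $\mathbf w\,\eta_{s'(\mathbf w)}^{s''(\mathbf w)}$ is a string. If $s''(\mathbf w)=+1$ put $\mathbf w[1]=\mathbf w\,\eta_{s'(\mathbf w)}\mathbf r_{s'(\mathbf w)}$, which is again locally free with $s''=+1$; put $\mathbf w[0]=\mathbf w$ and $\mathbf w[k+1]=(\mathbf w[k])[1]$ for $k\in\mathbb N$. The $\mathbf r_i$ are locally free with $s''(\mathbf r_i)=+1$. *)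

theory Defs
  imports "HOL-Library.Disjoint_Sets"
begin

section \<open>The quiver\<close>

text \<open>The element \<open>(i\<^sub>k, i'\<^sub>k)\<close> of an orientation stands for an arrow
  \<open>\<eta>\<^sub>k : i'\<^sub>k \<rightarrow> i\<^sub>k\<close>, that is, it lists the target first.\<close>

definition orientation :: "nat \<Rightarrow> (nat \<times> nat) set \<Rightarrow> bool" where
  "orientation n \<Omega> \<longleftrightarrow>
     (\<exists>h t. (\<forall>k\<in>{1..n}. {h k, t k} = {k - 1, k}) \<and> \<Omega> = {(h k, t k) | k. k \<in> {1..n}})"

text \<open>\<open>Eps i\<close> is the loop at \<open>i\<close> (an arrow of the quiver only for \<open>i = 0\<close> and \<open>i = n\<close>),
  \<open>Eta k\<close> the arrow between \<open>k - 1\<close> and \<open>k\<close>.\<close>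

datatype arrow = Eps nat | Eta nat

definition arrows :: "nat \<Rightarrow> arrow set" where
  "arrows n = {Eps 0, Eps n} \<union> Eta ` {1..n}"

fun asrc :: "(nat \<times> nat) set \<Rightarrow> arrow \<Rightarrow> nat" where
  "asrc \<Omega> (Eps i) = i"
| "asrc \<Omega> (Eta k) = (if (k - 1, k) \<in> \<Omega> then k else k - 1)"

fun atgt :: "(nat \<times> nat) set \<Rightarrow> arrow \<Rightarrow> nat" where
  "atgt \<Omega> (Eps i) = i"
| "atgt \<Omega> (Eta k) = (if (k - 1, k) \<in> \<Omega> then k - 1 else k)"


section \<open>Strings\<close>

datatype sign = Pos | Neg

fun flip :: "sign \<Rightarrow> sign" where
  "flip Pos = Neg"
| "flip Neg = Pos"

text \<open>\<open>(a, Pos)\<close> is the direct letter \<open>a\<close>, \<open>(a, Neg)\<close> is its formal inverse.\<close>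

type_synonym letter = "arrow \<times> sign"

definition letter_inv :: "letter \<Rightarrow> letter" where
  "letter_inv l = (fst l, flip (snd l))"

definition lsrc :: "(nat \<times> nat) set \<Rightarrow> letter \<Rightarrow> nat" where
  "lsrc \<Omega> l = (case snd l of Pos \<Rightarrow> asrc \<Omega> (fst l) | Neg \<Rightarrow> atgt \<Omega> (fst l))"

definition ltgt :: "(nat \<times> nat) set \<Rightarrow> letter \<Rightarrow> nat" where
  "ltgt \<Omega> l = (case snd l of Pos \<Rightarrow> atgt \<Omega> (fst l) | Neg \<Rightarrow> asrc \<Omega> (fst l))"

text \<open>\<open>Triv i Pos\<close> is the trivial string at \<open>i\<close>, \<open>Triv i Neg\<close> its (different) inverse.\<close>

datatype qstring = Triv nat sign | Word "letter list"

definition linkable :: "(nat \<times> nat) set \<Rightarrow> letter \<Rightarrow> letter \<Rightarrow> bool" where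
  "linkable \<Omega> u v \<longleftrightarrow> lsrc \<Omega> u = ltgt \<Omega> v \<and> u \<noteq> v \<and> u \<noteq> letter_inv v"

fun is_string :: "nat \<Rightarrow> (nat \<times> nat) set \<Rightarrow> qstring \<Rightarrow> bool" where
  "is_string n \<Omega> (Triv i \<sigma>) \<longleftrightarrow> i \<le> n"
| "is_string n \<Omega> (Word ws) \<longleftrightarrow>
     ws \<noteq> [] \<and> (\<forall>l\<in>set ws. fst l \<in> arrows n) \<and> successively (linkable \<Omega>) ws"

fun str_length :: "qstring \<Rightarrow> nat" where
  "str_length (Triv i \<sigma>) = 0"
| "str_length (Word ws) = length ws"

fun str_inv :: "qstring \<Rightarrow> qstring" where
  "str_inv (Triv i \<sigma>) = Triv i (flip \<sigma>)"
| "str_inv (Word ws) = Word (rev (map letter_inv ws))"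

fun inverse_string :: "qstring \<Rightarrow> bool" where
  "inverse_string (Triv i \<sigma>) \<longleftrightarrow> True"
| "inverse_string (Word ws) \<longleftrightarrow> (\<forall>l\<in>set ws. snd l = Neg)"

text \<open>For strings \<open>u\<close> and \<open>v\<close>, \<open>composable n \<Omega> u v\<close> says that \<open>u v\<close> is a string. Around a trivial
  string at \<open>0\<close> or \<open>n\<close> no concatenation is declared possible; such concatenations play no role.\<close>

fun composable :: "nat \<Rightarrow> (nat \<times> nat) set \<Rightarrow> qstring \<Rightarrow> qstring \<Rightarrow> bool" where
  "composable n \<Omega> (Word u) (Word v) \<longleftrightarrow> linkable \<Omega> (last u) (hd v)"
| "composable n \<Omega> (Triv i \<sigma>) (Word v) \<longleftrightarrow>
     1 \<le> i \<and> i < n \<and> ltgt \<Omega> (hd v) = i \<and>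
     fst (hd v) = Eta (case \<sigma> of Pos \<Rightarrow> i + 1 | Neg \<Rightarrow> i)"
| "composable n \<Omega> (Word u) (Triv i \<sigma>) \<longleftrightarrow>
     1 \<le> i \<and> i < n \<and> lsrc \<Omega> (last u) = i \<and>
     fst (last u) = Eta (case \<sigma> of Pos \<Rightarrow> i | Neg \<Rightarrow> i + 1)"
| "composable n \<Omega> (Triv i \<sigma>) (Triv j \<tau>) \<longleftrightarrow> i = j \<and> \<sigma> = \<tau> \<and> 1 \<le> i \<and> i < n"

fun str_concat :: "qstring \<Rightarrow> qstring \<Rightarrow> qstring" where
  "str_concat (Word u) (Word v) = Word (u @ v)"
| "str_concat (Word u) (Triv i \<sigma>) = Word u"
| "str_concat (Triv i \<sigma>) v = v"

fun loc_free :: "nat \<Rightarrow> (nat \<times> nat) set \<Rightarrow> qstring \<Rightarrow> bool" where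
  "loc_free n \<Omega> (Triv i \<sigma>) \<longleftrightarrow> i \<notin> {0, n}"
| "loc_free n \<Omega> (Word ws) \<longleftrightarrow>
     (lsrc \<Omega> (last ws) \<in> {0, n} \<longrightarrow> fst (last ws) = Eps (lsrc \<Omega> (last ws))) \<and>
     (ltgt \<Omega> (hd ws) \<in> {0, n} \<longrightarrow> fst (hd ws) = Eps (ltgt \<Omega> (hd ws)))"

definition St_lf :: "nat \<Rightarrow> (nat \<times> nat) set \<Rightarrow> qstring set" where
  "St_lf n \<Omega> = {w. is_string n \<Omega> w \<and> loc_free n \<Omega> w}"

fun vertex_seq :: "(nat \<times> nat) set \<Rightarrow> qstring \<Rightarrow> nat list" where
  "vertex_seq \<Omega> (Triv i \<sigma>) = [i]"
| "vertex_seq \<Omega> (Word ws) = map (ltgt \<Omega>) ws @ [lsrc \<Omega> (last ws)]"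

text \<open>Vectors indexed by \<open>{0..n}\<close> are functions on \<open>nat\<close> that vanish outside \<open>{0..n}\<close>. The division
  by \<open>2\<close> is exact on locally free strings, see \<open>even_count_vertex_seq\<close> below.\<close>

definition rk :: "nat \<Rightarrow> (nat \<times> nat) set \<Rightarrow> qstring \<Rightarrow> nat \<Rightarrow> int" where
  "rk n \<Omega> w i =
     (let c = int (count_list (vertex_seq \<Omega> w) i) in if i \<in> {0, n} then c div 2 else c)"

definition similar_letter :: "letter \<Rightarrow> letter \<Rightarrow> bool" where
  "similar_letter u v \<longleftrightarrow> u = v \<or> (\<exists>i. fst u = Eps i) \<and> v = letter_inv u"

fun similar :: "qstring \<Rightarrow> qstring \<Rightarrow> bool" where
  "similar (Word u) (Word v) \<longleftrightarrow> list_all2 similar_letter u v"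
| "similar u v \<longleftrightarrow> u = v"

definition sim_class :: "nat \<Rightarrow> (nat \<times> nat) set \<Rightarrow> qstring \<Rightarrow> qstring set" where
  "sim_class n \<Omega> w = {v. is_string n \<Omega> v \<and> similar w v}"

definition eta :: "nat \<Rightarrow> sign \<Rightarrow> qstring" where
  "eta k \<sigma> = Word [(Eta k, \<sigma>)]"

definition r_string :: "nat \<Rightarrow> (nat \<times> nat) set \<Rightarrow> nat \<Rightarrow> qstring" where
  "r_string n \<Omega> i = (THE r.
     (is_string n \<Omega> r \<and> inverse_string r \<and> composable n \<Omega> (eta i Pos) r) \<and>
     (\<forall>r'. is_string n \<Omega> r' \<and> inverse_string r' \<and> composable n \<Omega> (eta i Pos) r'
        \<longrightarrow> str_length r' \<le> str_length r))"

text \<open>The pair \<open>(s', s'')\<close>.\<close>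

definition next_eta :: "nat \<Rightarrow> (nat \<times> nat) set \<Rightarrow> qstring \<Rightarrow> nat \<times> sign" where
  "next_eta n \<Omega> w = (THE p. fst p \<in> {1..n} \<and> composable n \<Omega> w (eta (fst p) (snd p)))"

text \<open>The string \<open>w[1]\<close>, which is defined only if \<open>s'' = +1\<close>, and its iterates \<open>w[k]\<close>.\<close>

definition shift :: "nat \<Rightarrow> (nat \<times> nat) set \<Rightarrow> qstring \<Rightarrow> qstring" where
  "shift n \<Omega> w =
     (case next_eta n \<Omega> w of
        (i, Pos) \<Rightarrow> str_concat (str_concat w (eta i Pos)) (r_string n \<Omega> i)
      | (i, Neg) \<Rightarrow> undefined)"

definition shift_iter :: "nat \<Rightarrow> (nat \<times> nat) set \<Rightarrow> qstring \<Rightarrow> nat \<Rightarrow> qstring" where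
  "shift_iter n \<Omega> w k = (shift n \<Omega> ^^ k) w"


section \<open>Roots\<close>

definition cartan :: "nat \<Rightarrow> nat \<Rightarrow> nat \<Rightarrow> int" where
  "cartan n i j =
     (if i = j then 2
      else if (i, j) \<in> {(0, 1), (n, n - 1)} then -1
      else if (i, j) \<in> {(1, 0), (n - 1, n)} then -2
      else if j = i + 1 \<or> i = j + 1 then -1
      else 0)"

definition symm :: "nat \<Rightarrow> nat \<Rightarrow> int" where
  "symm n i = (if i \<in> {0, n} then 2 else 1)"

definition simple_root :: "nat \<Rightarrow> nat \<Rightarrow> int" where
  "simple_root i j = (if j = i then 1 else 0)"

text \<open>\<open>s\<^sub>i(\<beta>) = \<beta> - \<langle>\<beta>, \<alpha>\<^sub>i\<^sup>\<or>\<rangle> \<alpha>\<^sub>i\<close> with \<open>\<langle>\<alpha>\<^sub>j, \<alpha>\<^sub>i\<^sup>\<or>\<rangle> = c\<^sub>i\<^sub>j\<close>.\<close>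

definition reflection :: "nat \<Rightarrow> nat \<Rightarrow> (nat \<Rightarrow> int) \<Rightarrow> (nat \<Rightarrow> int)" where
  "reflection n i \<beta> = (\<lambda>j. \<beta> j - (\<Sum>m\<le>n. cartan n i m * \<beta> m) * simple_root i j)"

text \<open>The real roots of the Kac-Moody algebra are the elements of the orbits of the simple roots
  under the Weyl group. Their explicit list is \<open>pos_real_roots_explicit\<close> below.\<close>

inductive_set real_roots :: "nat \<Rightarrow> (nat \<Rightarrow> int) set" for n where
  simple: "i \<le> n \<Longrightarrow> simple_root i \<in> real_roots n"
| reflect: "\<beta> \<in> real_roots n \<Longrightarrow> i \<le> n \<Longrightarrow> reflection n i \<beta> \<in> real_roots n"

definition pos_real_roots :: "nat \<Rightarrow> (nat \<Rightarrow> int) set" where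
  "pos_real_roots n = {\<beta> \<in> real_roots n. \<forall>j. 0 \<le> \<beta> j}"

definition rho :: "nat \<Rightarrow> nat \<Rightarrow> int" where
  "rho n j = (if j \<in> {0, n} then 1 else if j < n then 2 else 0)"

definition pos_imag_roots :: "nat \<Rightarrow> (nat \<Rightarrow> int) set" where
  "pos_imag_roots n = {(\<lambda>j. k * rho n j) | k. k \<ge> 1}"

definition pos_roots :: "nat \<Rightarrow> (nat \<Rightarrow> int) set" where
  "pos_roots n = pos_real_roots n \<union> pos_imag_roots n"

definition long_root :: "nat \<Rightarrow> (nat \<Rightarrow> int) \<Rightarrow> bool" where
  "long_root n \<beta> \<longleftrightarrow>
     \<beta> \<in> real_roots n \<and> (\<Sum>i\<le>n. \<Sum>j\<le>n. \<beta> i * symm n i * cartan n i j * \<beta> j) = 4"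

section \<open>Consistency of the definitions\<close>

lemma loc_free_count_aux:
  assumes "x \<in> {0, n}" "n \<ge> 2" "ws \<noteq> []"
    and "\<forall>l\<in>set ws. fst l \<in> arrows n" "successively (linkable \<Omega>) ws"
    and "lsrc \<Omega> (last ws) = x \<longrightarrow> fst (last ws) = Eps x"
  shows "even (count_list (map (ltgt \<Omega>) ws @ [lsrc \<Omega> (last ws)]) x)
     \<longleftrightarrow> \<not> (ltgt \<Omega> (hd ws) = x \<and> fst (hd ws) \<noteq> Eps x)"
  using assms
proof (induction ws)
  case (Cons l ws)
  have la: "fst l \<in> arrows n" using Cons.prems by simp
  have eps: "lsrc \<Omega> l = x" "ltgt \<Omega> l = x" if "fst l = Eps x" for l
    using that by (auto simp: lsrc_def ltgt_def split: sign.splits)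
  have eta: "lsrc \<Omega> l \<noteq> ltgt \<Omega> l" if "fst l \<in> arrows n" "\<forall>i. fst l \<noteq> Eps i" for l
    using that by (auto simp: lsrc_def ltgt_def arrows_def split: sign.splits if_splits)
  have epsx: "fst l = Eps x" if "fst l = Eps i" "lsrc \<Omega> l = x \<or> ltgt \<Omega> l = x" for l i
    using that by (auto simp: lsrc_def ltgt_def split: sign.splits)
  show ?case
  proof (cases "ws = []")
    case True
    show ?thesis
    proof (cases "\<exists>i. fst l = Eps i")
      case True
      then show ?thesis using \<open>ws = []\<close> eps[of l] epsx[of l] by (auto 0 3)
    next
      case False
      then have "fst l \<noteq> Eps x" by blast
      then show ?thesis using False \<open>ws = []\<close> eta[of l] la Cons.prems by auto
    qed
  next
    case False
    let ?m = "hd ws"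
    have ma: "fst ?m \<in> arrows n" using Cons.prems False by simp
    have lk: "linkable \<Omega> l ?m" and suc: "successively (linkable \<Omega>) ws"
      using Cons.prems False by (auto simp: successively_Cons)
    have IH: "even (count_list (map (ltgt \<Omega>) ws @ [lsrc \<Omega> (last ws)]) x)
       \<longleftrightarrow> \<not> (ltgt \<Omega> ?m = x \<and> fst ?m \<noteq> Eps x)"
      using Cons False suc by simp
    have ne: "fst l \<noteq> fst ?m"
      using lk unfolding linkable_def letter_inv_def
      by (cases l; cases ?m; cases "snd l"; cases "snd ?m") auto
    have adj: "lsrc \<Omega> l = ltgt \<Omega> ?m" using lk by (simp add: linkable_def)
    have unique_eta: "fst p = Eta (if x = 0 then 1 else n)"
      if "fst p \<in> arrows n" "lsrc \<Omega> p = x \<or> ltgt \<Omega> p = x" "fst p \<noteq> Eps x" for p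
      using that assms(1,2)
      by (auto simp: lsrc_def ltgt_def arrows_def split: sign.splits if_splits)
    have k: "fst l = Eps x \<longleftrightarrow> fst ?m \<noteq> Eps x" if "ltgt \<Omega> ?m = x"
      using unique_eta[OF la] unique_eta[OF ma] that adj ne by metis
    have k2: "fst l \<noteq> Eps x" if "ltgt \<Omega> ?m \<noteq> x"
      using that adj eps(1)[of l] by auto
    have noloop: "ltgt \<Omega> l \<noteq> x" if "ltgt \<Omega> ?m = x" "fst l \<noteq> Eps x"
      using that eta[OF la] epsx[of l] adj by metis
    show ?thesis
      using IH k k2 noloop eps(2)[of l] False by (cases "ltgt \<Omega> ?m = x"; cases "fst l = Eps x") auto
  qed
qed simp

lemma even_count_vertex_seq:
  assumes "n \<ge> 2" "w \<in> St_lf n \<Omega>" "i \<in> {0, n}"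
  shows "even (count_list (vertex_seq \<Omega> w) i)"
proof (cases w)
  case (Triv j \<sigma>)
  then show ?thesis using assms by (auto simp: St_lf_def)
next
  case (Word ws)
  then show ?thesis
    using assms loc_free_count_aux[of i n ws \<Omega>] by (auto simp: St_lf_def)
qed

text \<open>For \<open>1 \<le> a, b \<le> n\<close> and \<open>\<sigma>, \<tau> \<in> {1, -1}\<close>, \<open>root_vec n k a \<sigma> b \<tau>\<close> is
  \<open>k \<rho> + \<sigma> e\<^sub>a + \<tau> e\<^sub>b\<close>, where \<open>\<alpha>\<^sub>i = e\<^sub>i - e\<^sub>i\<^sub>+\<^sub>1\<close> for \<open>1 \<le> i < n\<close> and \<open>\<alpha>\<^sub>n = 2 e\<^sub>n\<close>.\<close>

definition root_vec :: "nat \<Rightarrow> int \<Rightarrow> nat \<Rightarrow> int \<Rightarrow> nat \<Rightarrow> int \<Rightarrow> nat \<Rightarrow> int" where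
  "root_vec n k a \<sigma> b \<tau> =
     (\<lambda>m. if m = 0 then k
          else if m < n then 2 * k + (if a \<le> m then \<sigma> else 0) + (if b \<le> m then \<tau> else 0)
          else if m = n then k + (\<sigma> + \<tau>) div 2
          else 0)"

definition root_index :: "nat \<Rightarrow> nat \<Rightarrow> int \<Rightarrow> nat \<Rightarrow> int \<Rightarrow> bool" where
  "root_index n a \<sigma> b \<tau> \<longleftrightarrow> a \<in> {1..n} \<and> b \<in> {1..n} \<and> \<sigma> \<in> {1, -1} \<and> \<tau> \<in> {1, -1}
     \<and> (a = b \<longrightarrow> \<sigma> = \<tau>)"

definition swap :: "nat \<Rightarrow> nat \<Rightarrow> nat" where
  "swap i a = (if a = i then i + 1 else if a = i + 1 then i else a)"

lemma cartan_row_0: "n \<ge> 2 \<Longrightarrow> (\<Sum>m\<le>n. cartan n 0 m * \<beta> m) = 2 * \<beta> 0 - \<beta> 1"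
proof -
  assume "n \<ge> 2"
  then have "(\<Sum>m\<le>n. cartan n 0 m * \<beta> m) = (\<Sum>m\<in>{0, 1}. cartan n 0 m * \<beta> m)"
    by (intro sum.mono_neutral_right) (auto simp: cartan_def)
  then show ?thesis using \<open>n \<ge> 2\<close> by (auto simp: cartan_def)
qed

lemma cartan_row_n: "n \<ge> 2 \<Longrightarrow> (\<Sum>m\<le>n. cartan n n m * \<beta> m) = 2 * \<beta> n - \<beta> (n - 1)"
proof -
  assume "n \<ge> 2"
  then have "(\<Sum>m\<le>n. cartan n n m * \<beta> m) = (\<Sum>m\<in>{n - 1, n}. cartan n n m * \<beta> m)"
    by (intro sum.mono_neutral_right) (auto simp: cartan_def)
  then show ?thesis using \<open>n \<ge> 2\<close> by (auto simp: cartan_def)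
qed

lemma cartan_row_mid:
  assumes "1 \<le> i" "i < n"
  shows "(\<Sum>m\<le>n. cartan n i m * \<beta> m)
     = 2 * \<beta> i - (if i = 1 then 2 else 1) * \<beta> (i - 1) - (if i = n - 1 then 2 else 1) * \<beta> (i + 1)"
proof -
  obtain j where j: "i = Suc j" using assms(1) by (cases i) auto
  have "(\<Sum>m\<le>n. cartan n i m * \<beta> m) = (\<Sum>m\<in>{j, Suc j, Suc (Suc j)}. cartan n i m * \<beta> m)"
    using assms j by (intro sum.mono_neutral_right) (auto simp: cartan_def)
  also have "\<dots> = cartan n i j * \<beta> j + cartan n i (Suc j) * \<beta> (Suc j)
      + cartan n i (Suc (Suc j)) * \<beta> (Suc (Suc j))"
    by simp
  finally show ?thesis using assms j by (auto simp: cartan_def)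
qed

lemma reflection_0:
  assumes "n \<ge> 2" "root_index n a \<sigma> b \<tau>"
  shows "reflection n 0 (root_vec n k a \<sigma> b \<tau>) =
     root_vec n (k + (if a = 1 then \<sigma> else 0) + (if b = 1 then \<tau> else 0))
       a (if a = 1 then - \<sigma> else \<sigma>) b (if b = 1 then - \<tau> else \<tau>)"
  using assms unfolding reflection_def cartan_row_0[OF assms(1)]
  by (auto simp: fun_eq_iff root_vec_def root_index_def simple_root_def)

lemma reflection_n:
  assumes "n \<ge> 2" "root_index n a \<sigma> b \<tau>"
  shows "reflection n n (root_vec n k a \<sigma> b \<tau>) =
     root_vec n k a (if a = n then - \<sigma> else \<sigma>) b (if b = n then - \<tau> else \<tau>)"
  using assms unfolding reflection_def cartan_row_n[OF assms(1)]
  by (auto simp: fun_eq_iff root_vec_def root_index_def simple_root_def)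

lemma reflection_mid:
  assumes "1 \<le> i" "i < n" "root_index n a \<sigma> b \<tau>"
  shows "reflection n i (root_vec n k a \<sigma> b \<tau>) = root_vec n k (swap i a) \<sigma> (swap i b) \<tau>"
proof -
  have n: "n \<ge> 2" using assms by simp
  let ?B = "\<lambda>m. 2 * k + (if a \<le> m then \<sigma> else 0) + (if b \<le> m then \<tau> else 0)"
  have 1: "(if i = 1 then 2 else 1) * root_vec n k a \<sigma> b \<tau> (i - 1) = ?B (i - 1)"
    using assms by (auto simp: root_vec_def root_index_def)
  have 2: "(if i = n - 1 then 2 else 1) * root_vec n k a \<sigma> b \<tau> (i + 1) = ?B (i + 1)"
    using assms by (auto simp: root_vec_def root_index_def)
  have 3: "root_vec n k a \<sigma> b \<tau> i = ?B i"
    using assms by (auto simp: root_vec_def root_index_def)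
  have 4: "(\<Sum>m\<le>n. cartan n i m * root_vec n k a \<sigma> b \<tau> m) = 2 * ?B i - ?B (i - 1) - ?B (i + 1)"
    unfolding cartan_row_mid[OF assms(1,2)] 1 2 3 ..
  have 5: "(if swap i c \<le> m then s else 0) = (if c \<le> m then s else (0::int))" if "m \<noteq> i" for c m s
    using that by (auto simp: swap_def)
  have 6: "(if swap i c \<le> i then s else 0) =
      (if c \<le> i then s else 0) - (2 * (if c \<le> i then s else 0) - (if c \<le> i - 1 then s else 0)
       - (if c \<le> i + 1 then s else (0::int)))" if "1 \<le> c" for c s
    using that assms(1) by (auto simp: swap_def)
  show ?thesis
  proof
    fix m
    show "reflection n i (root_vec n k a \<sigma> b \<tau>) m = root_vec n k (swap i a) \<sigma> (swap i b) \<tau> m"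
    proof (cases "m = i")
      case True
      have "root_vec n k (swap i a) \<sigma> (swap i b) \<tau> i
          = 2 * k + (if swap i a \<le> i then \<sigma> else 0) + (if swap i b \<le> i then \<tau> else 0)"
        using assms(1,2) by (simp add: root_vec_def)
      then show ?thesis
        using 6[of a \<sigma>] 6[of b \<tau>] assms(3) True
        unfolding reflection_def 4 by (simp add: 3 simple_root_def root_index_def)
    next
      case False
      then show ?thesis
        unfolding reflection_def 4 by (simp add: simple_root_def root_vec_def 5)
    qed
  qed
qed

lemma root_index_swap:
  "1 \<le> i \<Longrightarrow> i < n \<Longrightarrow> root_index n a \<sigma> b \<tau> \<Longrightarrow> root_index n (swap i a) \<sigma> (swap i b) \<tau>"
proof -
  assume i: "1 \<le> i" "i < n" and r: "root_index n a \<sigma> b \<tau>"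
  have "swap i c \<in> {1..n}" if "c \<in> {1..n}" for c
    using that i by (simp add: swap_def)
  moreover have "a = b" if "swap i a = swap i b"
    using that unfolding swap_def by presburger
  ultimately show ?thesis using r unfolding root_index_def by metis
qed

lemma simple_root_vec:
  assumes "n \<ge> 2"
  shows "simple_root 0 = root_vec n 1 1 (-1) 1 (-1)"
    "simple_root n = root_vec n 0 n 1 n 1"
    "1 \<le> i \<Longrightarrow> i < n \<Longrightarrow> simple_root i = root_vec n 0 i 1 (i + 1) (-1)"
  using assms by (auto simp: simple_root_def root_vec_def fun_eq_iff)

lemma real_roots_root_vec:
  assumes n: "n \<ge> 2" and "\<beta> \<in> real_roots n"
  shows "\<exists>k a \<sigma> b \<tau>. root_index n a \<sigma> b \<tau> \<and> \<beta> = root_vec n k a \<sigma> b \<tau>"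
  using assms(2)
proof induction
  case (simple i)
  consider "i = 0" | "i = n" | "1 \<le> i" "i < n" using simple by linarith
  then show ?case
  proof cases
    case 1
    moreover have "root_index n 1 (-1) 1 (-1)" using n by (simp add: root_index_def)
    ultimately show ?thesis using simple_root_vec(1)[OF n] by blast
  next
    case 2
    moreover have "root_index n n 1 n 1" using n by (simp add: root_index_def)
    ultimately show ?thesis using simple_root_vec(2)[OF n] by blast
  next
    case 3
    moreover have "root_index n i 1 (i + 1) (-1)" using 3 by (simp add: root_index_def)
    ultimately show ?thesis using simple_root_vec(3)[OF n, of i] by blast
  qed
next
  case (reflect \<beta> i)
  then obtain k a \<sigma> b \<tau> where r: "root_index n a \<sigma> b \<tau>" and \<beta>: "\<beta> = root_vec n k a \<sigma> b \<tau>"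
    by blast
  have flipped: "root_index n a (if a = c then - \<sigma> else \<sigma>) b (if b = c then - \<tau> else \<tau>)" for c
    using r by (auto simp: root_index_def)
  consider "i = 0" | "i = n" | "1 \<le> i" "i < n" using reflect.hyps by linarith
  then show ?case
  proof cases
    case 1
    then show ?thesis using \<beta> reflection_0[OF n r] flipped[of 1] by metis
  next
    case 2
    then show ?thesis using \<beta> reflection_n[OF n r] flipped[of n] by metis
  next
    case 3
    then show ?thesis using \<beta> reflection_mid[OF _ _ r] root_index_swap[OF _ _ r] by metis
  qed
qed

lemma root_vec_commute: "root_vec n k a \<sigma> b \<tau> = root_vec n k b \<tau> a \<sigma>"
  by (auto simp: root_vec_def fun_eq_iff)

lemma int_step_induct:
  fixes P :: "int \<Rightarrow> bool"
  assumes "P k0" "\<And>k. P k \<longleftrightarrow> P (k + 1)"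
  shows "P k"
proof (induction k rule: int_induct[of _ k0])
  case base
  show ?case by (rule assms(1))
next
  case (step1 i)
  then show ?case using assms(2)[of i] by simp
next
  case (step2 i)
  then show ?case using assms(2)[of "i - 1"] by simp
qed

lemma root_vec_in_real_roots:
  assumes n: "n \<ge> 2" and r: "root_index n a \<sigma> b \<tau>"
  shows "root_vec n k a \<sigma> b \<tau> \<in> real_roots n"
proof -
  define P where "P k a \<sigma> b \<tau> \<longleftrightarrow> root_vec n k a \<sigma> b \<tau> \<in> real_roots n" for k a \<sigma> b \<tau>
  have P_commute: "P k a \<sigma> b \<tau> \<longleftrightarrow> P k b \<tau> a \<sigma>" for k a \<sigma> b \<tau>
    unfolding P_def by (simp add: root_vec_commute)
  have mid1: "P k (swap i a) \<sigma> (swap i b) \<tau>"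
    if "1 \<le> i" "i < n" "root_index n a \<sigma> b \<tau>" "P k a \<sigma> b \<tau>" for i k a \<sigma> b \<tau>
    using that real_roots.reflect[of _ n i] reflection_mid[OF that(1-3)] unfolding P_def
    by (metis less_imp_le)
  have swap2: "swap i (swap i a) = a" for i a by (simp add: swap_def)
  have mid: "P k (swap i a) \<sigma> (swap i b) \<tau> \<longleftrightarrow> P k a \<sigma> b \<tau>"
    if "1 \<le> i" "i < n" "root_index n a \<sigma> b \<tau>" for i k a \<sigma> b \<tau>
    using mid1[OF that] mid1[OF that(1,2) root_index_swap[OF that]] by (auto simp: swap2)
  have last1: "P k a (if a = n then - \<sigma> else \<sigma>) b (if b = n then - \<tau> else \<tau>)"
    if "root_index n a \<sigma> b \<tau>" "P k a \<sigma> b \<tau>" for k a \<sigma> b \<tau>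
    using that real_roots.reflect[of _ n n] reflection_n[OF n that(1)] unfolding P_def
    by (metis le_refl)
  have first1: "P (k + (if a = 1 then \<sigma> else 0) + (if b = 1 then \<tau> else 0))
       a (if a = 1 then - \<sigma> else \<sigma>) b (if b = 1 then - \<tau> else \<tau>)"
    if "root_index n a \<sigma> b \<tau>" "P k a \<sigma> b \<tau>" for k a \<sigma> b \<tau>
    using that real_roots.reflect[of _ n 0] reflection_0[OF n that(1)] unfolding P_def
    by (metis le0)
  have "P k a \<sigma> b \<tau>"
  proof (cases "a = b")
    case True
    have L_1: "P k a \<sigma> a \<sigma> \<longleftrightarrow> P k 1 \<sigma> 1 \<sigma>" if "1 \<le> a" "a \<le> n" "\<sigma> \<in> {1, -1}" for k a \<sigma>
      using that(1,2)
    proof (induction a rule: nat_induct_at_least)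
      case (Suc m)
      then show ?case
        using mid[of m m \<sigma> m \<sigma> k] that(3) by (simp add: swap_def root_index_def)
    qed simp
    have sign1: "P k 1 (- \<sigma>) 1 (- \<sigma>)" if "P k 1 \<sigma> 1 \<sigma>" "\<sigma> \<in> {1, -1}" for k \<sigma>
    proof -
      have "P k n \<sigma> n \<sigma>" using L_1[of n \<sigma>] that n by simp
      then have "P k n (- \<sigma>) n (- \<sigma>)"
        using last1[of n \<sigma> n \<sigma>] that(2) n by (simp add: root_index_def)
      then show ?thesis using L_1[of n "- \<sigma>"] that n by auto
    qed
    have sgn: "P k 1 \<sigma> 1 \<sigma> \<longleftrightarrow> P k 1 1 1 1" if "\<sigma> \<in> {1, -1}" for k \<sigma>
      using sign1[of k 1] sign1[of k "-1"] that by auto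
    have up: "P (k + 2) 1 1 1 1" if "P k 1 1 1 1" for k
      using first1[of 1 1 1 1 k] that n sgn[of "-1" "k + 2"] by (simp add: root_index_def add.assoc)
    have down: "P (k - 2) 1 1 1 1" if "P k 1 1 1 1" for k
      using first1[of 1 "-1" 1 "-1" k] that n sgn[of "-1" k] by (simp add: root_index_def)
    have step: "P (k0 + 2 * j) 1 1 1 1" if "P k0 1 1 1 1" for k0 j
    proof (rule int_step_induct[of "\<lambda>j. P (k0 + 2 * j) 1 1 1 1" 0])
      show "P (k0 + 2 * 0) 1 1 1 1" using that by simp
      show "P (k0 + 2 * j) 1 1 1 1 = P (k0 + 2 * (j + 1)) 1 1 1 1" for j
        using up[of "k0 + 2 * j"] down[of "k0 + 2 * (j + 1)"] by (auto simp: algebra_simps)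
    qed
    have "P 0 n 1 n 1"
      unfolding P_def using real_roots.simple[of n n] simple_root_vec(2)[OF n] by simp
    then have even: "P 0 1 1 1 1" using L_1[of n 1] n by simp
    have "P 1 1 (-1) 1 (-1)"
      unfolding P_def using real_roots.simple[of 0 n] simple_root_vec(1)[OF n] by simp
    then have odd: "P 1 1 1 1 1" using sgn[of "-1"] by simp
    have "P k 1 1 1 1"
    proof (cases "Parity.even k")
      case True
      then show ?thesis using step[OF even, of "k div 2"] by simp
    next
      case False
      then have "1 + 2 * (k div 2) = k" by presburger
      then show ?thesis using step[OF odd, of "k div 2"] by metis
    qed
    then show ?thesis using True r L_1[of a \<sigma> k] sgn[of \<sigma> k] by (simp add: root_index_def)
  next
    case False
    have low: "P k a \<sigma> b \<tau> \<longleftrightarrow> P k 1 \<sigma> b \<tau>"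
      if "1 \<le> a" "a < b" "b \<le> n" "\<sigma> \<in> {1, -1}" "\<tau> \<in> {1, -1}" for k a \<sigma> b \<tau>
      using that(1,2)
    proof (induction a rule: nat_induct_at_least)
      case (Suc m)
      then show ?case
        using mid[of m m \<sigma> b \<tau> k] that(3-5) by (simp add: swap_def root_index_def)
    qed simp
    have high: "P k 1 \<sigma> b \<tau> \<longleftrightarrow> P k 1 \<sigma> 2 \<tau>"
      if "2 \<le> b" "b \<le> n" "\<sigma> \<in> {1, -1}" "\<tau> \<in> {1, -1}" for k b \<sigma> \<tau>
      using that(1,2)
    proof (induction b rule: nat_induct_at_least)
      case (Suc m)
      then show ?case
        using mid[of m 1 \<sigma> m \<tau> k] that(3,4) by (simp add: swap_def root_index_def)
    qed simp
    define Q where "Q k \<sigma> \<tau> \<longleftrightarrow> P k 1 \<sigma> 2 \<tau>" for k \<sigma> \<tau>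
    have Q_commute: "Q k \<sigma> \<tau> \<longleftrightarrow> Q k \<tau> \<sigma>" if "\<sigma> \<in> {1, -1}" "\<tau> \<in> {1, -1}" for k \<sigma> \<tau>
      using mid[of 1 1 \<sigma> 2 \<tau> k] that n P_commute[of k 1 \<tau> 2 \<sigma>] unfolding Q_def
      by (simp add: swap_def root_index_def numeral_2_eq_2)
    have Q_sign1: "Q k \<sigma> (- \<tau>)" if "Q k \<sigma> \<tau>" "\<sigma> \<in> {1, -1}" "\<tau> \<in> {1, -1}" for k \<sigma> \<tau>
    proof -
      have "P k 1 \<sigma> n \<tau>" using that high[of n \<sigma> \<tau>] n by (simp add: Q_def)
      then have "P k 1 \<sigma> n (- \<tau>)"
        using last1[of 1 \<sigma> n \<tau> k] that n by (simp add: root_index_def)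
      then show ?thesis using that high[of n \<sigma> "- \<tau>"] n by (auto simp: Q_def)
    qed
    have Q_11: "Q k \<sigma> \<tau> \<longleftrightarrow> Q k 1 1" if "\<sigma> \<in> {1, -1}" "\<tau> \<in> {1, -1}" for k \<sigma> \<tau>
    proof -
      have second: "Q k \<sigma> \<tau> \<longleftrightarrow> Q k \<sigma> 1" if "\<sigma> \<in> {1, -1}" "\<tau> \<in> {1, -1}" for \<sigma> \<tau>
        using Q_sign1[of k \<sigma> 1] Q_sign1[of k \<sigma> "-1"] that by auto
      have "Q k \<sigma> \<tau> \<longleftrightarrow> Q k \<sigma> 1" by (rule second[OF that])
      also have "\<dots> \<longleftrightarrow> Q k 1 \<sigma>" using that by (intro Q_commute) simp_all
      also have "\<dots> \<longleftrightarrow> Q k 1 1" using that by (intro second) simp_all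
      finally show ?thesis .
    qed
    have up: "Q (k + 1) 1 1" if "Q k 1 1" for k
      using first1[of 1 1 2 1 k] that n Q_11[of "-1" 1 "k + 1"] by (simp add: root_index_def Q_def)
    have down: "Q (k - 1) 1 1" if "Q k 1 1" for k
      using first1[of 1 "-1" 2 1 k] that n Q_11[of "-1" 1 k] by (simp add: root_index_def Q_def)
    have "Q 0 1 (-1)"
      unfolding Q_def P_def using real_roots.simple[of 1 n] simple_root_vec(3)[OF n, of 1] n
      by (simp add: numeral_2_eq_2)
    then have "Q 0 1 1" using Q_11[of 1 "-1"] by simp
    moreover have "Q k 1 1 \<longleftrightarrow> Q (k + 1) 1 1" for k
      using up[of k] down[of "k + 1"] by auto
    ultimately have Q: "Q k 1 1" using int_step_induct[of "\<lambda>k. Q k 1 1" 0] by blast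
    have lt: "P k a \<sigma> b \<tau>" if "a < b" "root_index n a \<sigma> b \<tau>" for a \<sigma> b \<tau>
      using that low[of a b \<sigma> \<tau> k] high[of b \<sigma> \<tau> k] Q Q_11[of \<sigma> \<tau> k]
      by (simp add: root_index_def Q_def)
    have "root_index n b \<tau> a \<sigma>" using r by (auto simp: root_index_def)
    then show ?thesis
      using lt[of a b \<sigma> \<tau>] lt[of b a \<tau> \<sigma>] r False P_commute[of k a \<sigma> b \<tau>] by linarith
  qed
  then show ?thesis by (simp add: P_def)
qed

definition alpha_sum :: "nat \<Rightarrow> nat \<Rightarrow> nat \<Rightarrow> int" where
  "alpha_sum i j = (\<lambda>m. \<Sum>k\<in>{i..j}. simple_root k m)"

definition beta_sum :: "nat \<Rightarrow> nat \<Rightarrow> nat \<Rightarrow> nat \<Rightarrow> int" where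
  "beta_sum n i j = (\<lambda>m. alpha_sum i n m + alpha_sum j (n - 1) m)"

definition pos_finite_roots :: "nat \<Rightarrow> (nat \<Rightarrow> int) set" where
  "pos_finite_roots n = {alpha_sum i j | i j. 1 \<le> i \<and> i \<le> j \<and> j \<le> n}
     \<union> {beta_sum n i j | i j. 1 \<le> i \<and> i \<le> j \<and> j \<le> n - 1}"

lemma alpha_sum_eq: "alpha_sum i j m = (if i \<le> m \<and> m \<le> j then 1 else 0)"
  unfolding alpha_sum_def simple_root_def by simp

lemma alpha_sum_root_vec:
  assumes "1 \<le> i" "i \<le> j" "j \<le> n"
  shows "(\<lambda>m. k * rho n m + s * alpha_sum i j m) =
     (if j < n then root_vec n k i s (j + 1) (- s) else root_vec n k i s n s)"
  using assms by (auto simp: fun_eq_iff alpha_sum_eq rho_def root_vec_def)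

lemma beta_sum_root_vec:
  assumes "1 \<le> i" "i \<le> j" "j \<le> n - 1"
  shows "(\<lambda>m. k * rho n m + s * beta_sum n i j m) = root_vec n k i s j s"
  using assms by (auto simp: fun_eq_iff beta_sum_def alpha_sum_eq rho_def root_vec_def)

lemma pos_finite_root_vec:
  assumes "n \<ge> 2" "\<gamma> \<in> pos_finite_roots n" "s \<in> {1, -1}"
  shows "\<exists>a \<sigma> b \<tau>. root_index n a \<sigma> b \<tau> \<and> (\<lambda>m. k * rho n m + s * \<gamma> m) = root_vec n k a \<sigma> b \<tau>"
proof -
  consider i j where "\<gamma> = alpha_sum i j" "1 \<le> i" "i \<le> j" "j \<le> n"
    | i j where "\<gamma> = beta_sum n i j" "1 \<le> i" "i \<le> j" "j \<le> n - 1"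
    using assms(2) unfolding pos_finite_roots_def by blast
  then show ?thesis
  proof cases
    case (1 i j)
    have "root_index n i s (j + 1) (- s)" if "j < n"
      using 1 that assms(3) by (auto simp: root_index_def)
    moreover have "root_index n i s n s" using 1 assms(3) by (auto simp: root_index_def)
    ultimately show ?thesis using alpha_sum_root_vec[OF 1(2-4), of k s] 1(1) by metis
  next
    case (2 i j)
    have "root_index n i s j s" using 2 assms(1,3) by (auto simp: root_index_def)
    then show ?thesis using beta_sum_root_vec[OF 2(2-4), of k s] 2(1) by metis
  qed
qed

lemma root_vec_pos_finite_le:
  assumes "n \<ge> 2" "root_index n a \<sigma> b \<tau>" "a \<le> b"
  shows "\<exists>\<gamma>\<in>pos_finite_roots n. \<exists>s\<in>{1, -1}. root_vec n k a \<sigma> b \<tau> = (\<lambda>m. k * rho n m + s * \<gamma> m)"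
proof -
  have s: "\<sigma> \<in> {1, -1}" using assms by (simp add: root_index_def)
  consider "\<tau> = - \<sigma>" "a < b" | "\<tau> = \<sigma>" "b = n" | "\<tau> = \<sigma>" "b < n"
    using assms by (fastforce simp: root_index_def)
  then show ?thesis
  proof cases
    case 1
    have "alpha_sum a (b - 1) \<in> pos_finite_roots n"
      using 1 assms by (force simp: pos_finite_roots_def root_index_def)
    moreover have "root_vec n k a \<sigma> b \<tau> = (\<lambda>m. k * rho n m + \<sigma> * alpha_sum a (b - 1) m)"
      using alpha_sum_root_vec[of a "b - 1" n k \<sigma>] 1 assms by (auto simp: root_index_def)
    ultimately show ?thesis using s by blast
  next
    case 2
    have "alpha_sum a n \<in> pos_finite_roots n"
      using 2 assms by (force simp: pos_finite_roots_def root_index_def)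
    moreover have "root_vec n k a \<sigma> b \<tau> = (\<lambda>m. k * rho n m + \<sigma> * alpha_sum a n m)"
      using alpha_sum_root_vec[of a n n k \<sigma>] 2 assms by (auto simp: root_index_def)
    ultimately show ?thesis using s by blast
  next
    case 3
    have "beta_sum n a b \<in> pos_finite_roots n"
      using 3 assms by (force simp: pos_finite_roots_def root_index_def)
    moreover have "root_vec n k a \<sigma> b \<tau> = (\<lambda>m. k * rho n m + \<sigma> * beta_sum n a b m)"
      using beta_sum_root_vec[of a b n k \<sigma>] 3 assms by (auto simp: root_index_def)
    ultimately show ?thesis using s by blast
  qed
qed

lemma real_roots_explicit:
  assumes n: "n \<ge> 2"
  shows "real_roots n = {(\<lambda>m. k * rho n m + s * \<gamma> m) | k s \<gamma>. s \<in> {1, -1} \<and> \<gamma> \<in> pos_finite_roots n}"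
    (is "_ = ?R")
proof
  show "real_roots n \<subseteq> ?R"
  proof
    fix \<beta> assume "\<beta> \<in> real_roots n"
    then obtain k a \<sigma> b \<tau> where r: "root_index n a \<sigma> b \<tau>" and \<beta>: "\<beta> = root_vec n k a \<sigma> b \<tau>"
      using real_roots_root_vec[OF n] by blast
    have r': "root_index n b \<tau> a \<sigma>" using r by (auto simp: root_index_def)
    have "\<exists>\<gamma>\<in>pos_finite_roots n. \<exists>s\<in>{1, -1}. \<beta> = (\<lambda>m. k * rho n m + s * \<gamma> m)"
    proof (cases "a \<le> b")
      case True
      then show ?thesis using root_vec_pos_finite_le[OF n r] \<beta> by simp
    next
      case False
      then show ?thesis
        using root_vec_pos_finite_le[OF n r', of k] \<beta> root_vec_commute[of n k a \<sigma> b \<tau>] by simp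
    qed
    then show "\<beta> \<in> ?R" by blast
  qed
  show "?R \<subseteq> real_roots n"
  proof
    fix \<beta> assume "\<beta> \<in> ?R"
    then obtain k s \<gamma> where "s \<in> {1, -1}" "\<gamma> \<in> pos_finite_roots n"
      and \<beta>: "\<beta> = (\<lambda>m. k * rho n m + s * \<gamma> m)"
      by blast
    then obtain a \<sigma> b \<tau> where "root_index n a \<sigma> b \<tau>" "\<beta> = root_vec n k a \<sigma> b \<tau>"
      using pos_finite_root_vec[OF n, of \<gamma> s k] by blast
    then show "\<beta> \<in> real_roots n" using root_vec_in_real_roots[OF n] by simp
  qed
qed

lemma pos_finite_roots_bounds:
  assumes "\<gamma> \<in> pos_finite_roots n" "n \<ge> 2"
  shows "\<gamma> 0 = 0" "0 \<le> \<gamma> m" "\<gamma> m \<le> rho n m" "\<exists>m. \<gamma> m > 0"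
proof -
  show "\<gamma> 0 = 0" "0 \<le> \<gamma> m" "\<gamma> m \<le> rho n m"
    using assms by (auto simp: pos_finite_roots_def beta_sum_def alpha_sum_eq rho_def)
  have "\<exists>m. 0 < alpha_sum i j m" if "i \<le> j" for i j
    using that by (intro exI[of _ i]) (simp add: alpha_sum_eq)
  moreover have "\<exists>m. 0 < beta_sum n i j m" if "i \<le> j" "j \<le> n - 1" for i j
    using that assms(2) by (intro exI[of _ n]) (simp add: beta_sum_def alpha_sum_eq)
  ultimately show "\<exists>m. \<gamma> m > 0"
    using assms(1) by (auto simp: pos_finite_roots_def)
qed

lemma pos_real_roots_explicit:
  assumes n: "n \<ge> 2"
  shows "pos_real_roots n =
     {(\<lambda>m. k * rho n m + \<gamma> m) | k \<gamma>. k \<ge> 0 \<and> \<gamma> \<in> pos_finite_roots n} \<union>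
     {(\<lambda>m. k * rho n m - \<gamma> m) | k \<gamma>. k \<ge> 1 \<and> \<gamma> \<in> pos_finite_roots n}" (is "_ = ?P \<union> ?N")
proof
  show "pos_real_roots n \<subseteq> ?P \<union> ?N"
  proof
    fix \<beta> assume "\<beta> \<in> pos_real_roots n"
    then have \<beta>R: "\<beta> \<in> real_roots n" and pos: "\<And>m. 0 \<le> \<beta> m"
      by (auto simp: pos_real_roots_def)
    then obtain k s \<gamma> where s: "s \<in> {1, -1}" and \<gamma>: "\<gamma> \<in> pos_finite_roots n"
      and \<beta>: "\<beta> = (\<lambda>m. k * rho n m + s * \<gamma> m)"
      using real_roots_explicit[OF n] by auto
    have k: "0 \<le> k"
      using pos[of 0] \<beta> pos_finite_roots_bounds(1)[OF \<gamma> n] by (simp add: rho_def)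
    show "\<beta> \<in> ?P \<union> ?N"
    proof (cases "s = 1")
      case True
      then show ?thesis using k \<gamma> \<beta> by auto
    next
      case False
      then have s1: "s = -1" using s by simp
      obtain m where "\<gamma> m > 0" using pos_finite_roots_bounds(4)[OF \<gamma> n] by blast
      then have "k \<noteq> 0" using pos[of m] \<beta> s1 by auto
      then show ?thesis using k \<gamma> \<beta> s1 by fastforce
    qed
  qed
  have rho: "0 \<le> rho n m" for m by (simp add: rho_def)
  show "?P \<union> ?N \<subseteq> pos_real_roots n"
  proof
    fix \<beta> assume "\<beta> \<in> ?P \<union> ?N"
    then obtain k s \<gamma> where s: "s = 1 \<and> k \<ge> 0 \<or> s = -1 \<and> k \<ge> 1" and \<gamma>: "\<gamma> \<in> pos_finite_roots n"
      and \<beta>: "\<beta> = (\<lambda>m. k * rho n m + s * \<gamma> m)"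
      by fastforce
    have "\<beta> \<in> real_roots n" using real_roots_explicit[OF n] s \<gamma> \<beta> by blast
    moreover have "0 \<le> \<beta> m" for m
    proof (cases "s = 1")
      case True
      then show ?thesis using s \<beta> rho[of m] pos_finite_roots_bounds(2)[OF \<gamma> n, of m] by simp
    next
      case False
      then have "1 * rho n m \<le> k * rho n m" using s rho[of m] by (intro mult_right_mono) auto
      then show ?thesis using False s \<beta> pos_finite_roots_bounds(3)[OF \<gamma> n, of m] by auto
    qed
    ultimately show "\<beta> \<in> pos_real_roots n" by (simp add: pos_real_roots_def)
  qed
qed

end

theory Submission
  imports Defs
begin

text \<open>Reading a string letter by letter is walking along the path \<open>0 - 1 - \<dots> - n\<close>, where a loop
at an end lets the walk reverse. Two neighbouring letters never come from the same arrow, so away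
from the ends the walk cannot reverse, and at an end it must go through the loop and then return.
Up to the choice of \<open>\<epsilon>\<close> or \<open>\<epsilon>\<^sup>-\<^sup>1\<close> for each loop, which is what similarity ignores, a string is therefore
determined by its starting vertex, its direction and its length. This suggests unfolding the path:
the integers are folded onto \<open>{0..n}\<close> by the translation \<open>x \<mapsto> x + 2 (n + 1)\<close> and the reflection
\<open>x \<mapsto> - 1 - x\<close>, and a string is, up to similarity, a walk \<open>p, p + 1, \<dots>, p + l\<close> to the right, where
\<open>p\<close> is unique modulo the period \<open>2 (n + 1)\<close> (lemmas \<open>similar_walk_exists\<close> and \<open>similar_walk_iff\<close>).

Let \<open>e = p + l + 1\<close> be the first position behind the walk. Inversion of strings is
\<open>(p, e) \<mapsto> (- e, - p)\<close> (lemma \<open>str_inv_walk\<close>), and the string is locally free iff neither \<open>p\<close> nor \<open>e\<close>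
is a multiple of \<open>n + 1\<close> (lemma \<open>loc_free_walk\<close>). The positions \<open>x\<close> that are not multiples of \<open>n + 1\<close>
are in bijection with triples of an integer \<open>x div period\<close>, an index \<open>a \<in> {1..n}\<close> and a sign \<open>s\<close>.
In the notation of the root vectors \<open>k \<rho> + \<sigma> e\<^sub>a + \<tau> e\<^sub>b\<close>, counting the vertices in \<open>[0, x)\<close>, with
weight one half at \<open>0\<close> and \<open>n\<close>, gives \<open>(x div period + 1/2) \<rho> + s e\<^sub>a\<close>. Subtracting the values at
\<open>e\<close> and \<open>p\<close> shows that the rank of the string is
\<open>(e div period - p div period) \<rho> + s\<^sub>e e\<^sub>a - s\<^sub>p e\<^sub>b\<close> (lemma \<open>rk_walk\<close>).

All three claims can be read off this formula. If \<open>e\<close> and \<open>p\<close> are not congruent modulo the period,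
the rank is a real root, and every positive real root arises, since \<open>e < p\<close> would make it
negative. The root determines the unordered pair of \<open>s\<^sub>e e\<^sub>a\<close> and \<open>- s\<^sub>p e\<^sub>b\<close> and the coefficient of
\<open>\<rho>\<close>; the two orders of the pair are the string and its inverse, which are similar iff the two
vectors are equal, that is, iff the root is long (lemmas \<open>rank_eq_iff\<close> and \<open>long_rank_iff\<close>).
If \<open>e - p = k \<cdot> period\<close>, the rank is \<open>k \<rho>\<close>, and \<open>p\<close> may be any of the \<open>2 n\<close> admissible residues.

To name these residues by the strings \<open>r\<^sub>i[n k - 1]\<close>, let \<open>c\<^sub>i\<close> be the position at which
the direct letter \<open>\<eta>\<^sub>i\<close> ends when it is read to the right. One has \<open>c\<^sub>i = i\<close> or \<open>c\<^sub>i = - i\<close>, so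
the \<open>\<plusminus> c\<^sub>i\<close> represent the \<open>2 n\<close> residues exactly once. The string \<open>r\<^sub>i\<close> is the walk that starts at
\<open>c\<^sub>i\<close> and stops before the next direct \<open>\<eta>\<close>, and each shift appends that letter
and continues up to the following one. A period contains each direct \<open>\<eta>\<^sub>j\<close> once, so \<open>r\<^sub>i[n k - 1]\<close> covers exactly \<open>k\<close> periods
(lemma \<open>shift_iter_r_string\<close>).\<close>

section \<open>Root vectors\<close>

text \<open>Along \<open>1, \<dots>, n\<close> the vector \<open>k \<rho> + \<sigma> e\<^sub>a + \<tau> e\<^sub>b\<close>, doubled at the ends, jumps only at \<open>a\<close> and \<open>b\<close>.
  Comparing jumps also covers the degenerate case \<open>a = b\<close>, \<open>\<sigma> = - \<tau>\<close>, which gives the imaginary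
  roots.\<close>

lemma root_vec_eq_jumps:
  assumes n: "n \<ge> 2"
    and r: "a \<in> {1..n}" "b \<in> {1..n}" "\<sigma> \<in> {1, -1}" "\<tau> \<in> {1, -1}"
    and r': "a' \<in> {1..n}" "b' \<in> {1..n}" "\<sigma>' \<in> {1, -1}" "\<tau>' \<in> {1, -1}"
    and eq: "root_vec n k a \<sigma> b \<tau> = root_vec n k' a' \<sigma>' b' \<tau>'"
  shows "k = k'"
    "(if m = a then \<sigma> else 0) + (if m = b then \<tau> else 0)
      = (if m = a' then \<sigma>' else 0) + (if m = b' then \<tau>' else 0)"
proof -
  have eqm: "root_vec n k a \<sigma> b \<tau> m = root_vec n k' a' \<sigma>' b' \<tau>' m" for m using eq by simp
  show k: "k = k'" using eqm[of 0] by (simp add: root_vec_def)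
  let ?B = "\<lambda>m. (if a \<le> m then \<sigma> else 0) + (if b \<le> m then \<tau> else 0)"
  let ?B' = "\<lambda>m. (if a' \<le> m then \<sigma>' else 0) + (if b' \<le> m then \<tau>' else 0)"
  have B: "?B m = ?B' m" if m: "m \<le> n" for m
  proof -
    consider "m = 0" | "0 < m" "m < n" | "m = n" using m by linarith
    then show ?thesis
    proof cases
      case 1
      then show ?thesis using r r' by simp
    next
      case 2
      then show ?thesis using eqm[of m] k by (simp add: root_vec_def)
    next
      case 3
      have "(\<sigma> + \<tau>) div 2 = (\<sigma>' + \<tau>') div 2" using eqm[of n] k n by (simp add: root_vec_def)
      then have "\<sigma> + \<tau> = \<sigma>' + \<tau>'" using r r' by auto
      then show ?thesis using 3 r r' by simp
    qed
  qed
  show "(if m = a then \<sigma> else 0) + (if m = b then \<tau> else 0)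
      = (if m = a' then \<sigma>' else 0) + (if m = b' then \<tau>' else 0)"
  proof (cases "m \<in> {1..n}")
    case True
    then have "(if c \<le> m then s else 0) = (if c \<le> m - 1 then s else 0) + (if m = c then s else (0::int))" for c s
      by auto
    note this[of a \<sigma>] this[of b \<tau>] this[of a' \<sigma>'] this[of b' \<tau>']
    moreover have "m \<le> n" "m - 1 \<le> n" using True by auto
    note B[OF this(1)] B[OF this(2)]
    ultimately show ?thesis by linarith
  next
    case False
    then show ?thesis using r r' by auto
  qed
qed

text \<open>The jumps, which cannot cancel on the left-hand side, give back the unordered pair of
  \<open>\<sigma> e\<^sub>a\<close> and \<open>\<tau> e\<^sub>b\<close>. On the right-hand side they may cancel, so that the lemma also separates real
  roots from multiples of \<open>\<rho>\<close>.\<close>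

lemma root_vec_inject:
  assumes n: "n \<ge> 2" and r: "root_index n a \<sigma> b \<tau>"
    and r': "a' \<in> {1..n}" "b' \<in> {1..n}" "\<sigma>' \<in> {1, -1}" "\<tau>' \<in> {1, -1}"
    and eq: "root_vec n k a \<sigma> b \<tau> = root_vec n k' a' \<sigma>' b' \<tau>'"
  shows "k = k' \<and> (a = a' \<and> \<sigma> = \<sigma>' \<and> b = b' \<and> \<tau> = \<tau>' \<or> a = b' \<and> \<sigma> = \<tau>' \<and> b = a' \<and> \<tau> = \<sigma>')"
proof -
  have i: "a \<in> {1..n}" "b \<in> {1..n}" "\<sigma> \<in> {1, -1}" "\<tau> \<in> {1, -1}" "a = b \<longrightarrow> \<sigma> = \<tau>"
    using r by (simp_all add: root_index_def)
  note j = root_vec_eq_jumps[OF n i(1-4) r' eq]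
  show ?thesis
    using j(1) j(2)[of a] j(2)[of b] j(2)[of a'] j(2)[of b'] i(3-5) r'(3,4)
    by (smt (verit) insertE singletonD)
qed

lemma rho_root_vec: "n \<ge> 2 \<Longrightarrow> (\<lambda>j. k * rho n j) = root_vec n k 1 1 1 (-1)"
  by (auto simp: root_vec_def rho_def fun_eq_iff)

lemma root_vec_not_imaginary:
  assumes "n \<ge> 2" "root_index n a \<sigma> b \<tau>"
  shows "root_vec n k a \<sigma> b \<tau> \<noteq> (\<lambda>j. k' * rho n j)"
proof
  assume "root_vec n k a \<sigma> b \<tau> = (\<lambda>j. k' * rho n j)"
  then have "root_vec n k a \<sigma> b \<tau> = root_vec n k' 1 1 1 (-1)" using rho_root_vec[OF assms(1)] by simp
  from root_vec_inject[OF assms _ _ _ _ this] show False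
    using assms by (auto simp: root_index_def)
qed

lemma imaginary_not_real:
  assumes "n \<ge> 2"
  shows "(\<lambda>j. k * rho n j) \<notin> real_roots n"
  using real_roots_root_vec[OF assms] root_vec_not_imaginary[OF assms] by metis

text \<open>Summation by parts. It turns the quadratic form of the Cartan matrix, evaluated with the
  partial sums \<open>f\<close> of \<open>u\<close>, into the standard form \<open>\<Sum> u\<^sub>i\<^sup>2\<close> in the coordinates \<open>e\<^sub>1, \<dots>, e\<^sub>n\<close>.\<close>

lemma sum_by_parts_squares:
  fixes f u :: "nat \<Rightarrow> int"
  assumes "\<And>i. 1 \<le> i \<Longrightarrow> i \<le> Suc n \<Longrightarrow> f i = f (i - 1) + u i"
  shows "- f 0 * u 1 + (\<Sum>i\<in>{1..n}. f i * (u i - u (i + 1))) + f (n + 1) * u (n + 1)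
     = (\<Sum>i\<in>{1..n + 1}. u i * u i)"
  using assms
proof (induction n)
  case 0
  then show ?case using 0[of 1] by (simp add: algebra_simps)
next
  case (Suc n)
  have "- f 0 * u 1 + (\<Sum>i\<in>{1..n}. f i * (u i - u (i + 1))) + f (n + 1) * u (n + 1)
     = (\<Sum>i\<in>{1..n + 1}. u i * u i)"
    using Suc by simp
  moreover have "f (n + 2) = f (n + 1) + u (n + 2)" using Suc.prems[of "n + 2"] by simp
  ultimately show ?case by (simp add: algebra_simps)
qed

text \<open>The form is \<open>\<bar>\<sigma> e\<^sub>a + \<tau> e\<^sub>b\<bar>\<^sup>2\<close> for orthonormal \<open>e\<^sub>1, \<dots>, e\<^sub>n\<close>, because \<open>\<rho>\<close> is in its radical.\<close>

lemma root_vec_norm: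
  fixes k :: int
  assumes n: "n \<ge> 2" and r: "root_index n a \<sigma> b \<tau>"
  defines "\<beta> \<equiv> root_vec n k a \<sigma> b \<tau>"
  shows "(\<Sum>i\<le>n. \<Sum>j\<le>n. \<beta> i * symm n i * cartan n i j * \<beta> j) = (if a = b then 4 else 2)"
proof -
  have i: "a \<in> {1..n}" "b \<in> {1..n}" "\<sigma> \<in> {1, -1}" "\<tau> \<in> {1, -1}" "a = b \<longrightarrow> \<sigma> = \<tau>"
    using r by (simp_all add: root_index_def)
  define B where "B m = 2 * k + (if a \<le> m then \<sigma> else 0) + (if b \<le> m then \<tau> else 0)" for m
  define u where "u m = (if m = a then \<sigma> else 0) + (if m = b then \<tau> else 0)" for m
  have B: "B m = B (m - 1) + u m" if "1 \<le> m" for m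
    using that unfolding B_def u_def by auto
  have \<beta>0: "2 * \<beta> 0 = B 0" and \<beta>n: "2 * \<beta> n = B n"
    using i n by (auto simp: \<beta>_def root_vec_def B_def)
  have \<beta>m: "\<beta> m = B m" if "1 \<le> m" "m < n" for m
    using that by (simp add: \<beta>_def root_vec_def B_def)
  \<comment> \<open>Pairing with the \<open>i\<close>-th coroot only sees the jumps \<open>u i\<close> and \<open>u (i + 1)\<close>, also for the end rows, where \<open>\<beta>\<close> is half of \<open>B\<close>.\<close>
  define c where "c i = (\<Sum>j\<le>n. cartan n i j * \<beta> j)" for i
  have c0: "c 0 = - u 1"
    unfolding c_def cartan_row_0[OF n] using B[of 1] \<beta>m[of 1] \<beta>0 n by simp
  have cn: "c n = u n"
    unfolding c_def cartan_row_n[OF n] using B[of n] \<beta>m[of "n - 1"] \<beta>n n by simp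
  have cm: "c m = u m - u (m + 1)" if m: "1 \<le> m" "m < n" for m
  proof -
    have "(if m = 1 then 2 else 1) * \<beta> (m - 1) = B (m - 1)" using \<beta>0 \<beta>m[of "m - 1"] m by auto
    moreover have "(if m = n - 1 then 2 else 1) * \<beta> (m + 1) = B (m + 1)"
      using \<beta>n \<beta>m[of "m + 1"] m by auto
    ultimately show ?thesis
      unfolding c_def cartan_row_mid[OF m] using B[of m] B[of "m + 1"] \<beta>m[OF m] m by simp
  qed
  obtain n' where n': "n = Suc n'" using n by (cases n) auto
  have "(\<Sum>i\<le>n. \<Sum>j\<le>n. \<beta> i * symm n i * cartan n i j * \<beta> j) = (\<Sum>i\<le>n. \<beta> i * symm n i * c i)"
    by (simp add: c_def sum_distrib_left mult.assoc)
  also have "\<dots> = (\<Sum>i\<in>insert 0 (insert n {1..n'}). \<beta> i * symm n i * c i)"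
    using n' by (intro sum.cong) auto
  also have "\<dots> = \<beta> 0 * 2 * c 0 + (\<Sum>i\<in>{1..n'}. \<beta> i * symm n i * c i) + \<beta> n * 2 * c n"
    using n' by (simp add: symm_def)
  also have "(\<Sum>i\<in>{1..n'}. \<beta> i * symm n i * c i) = (\<Sum>i\<in>{1..n'}. B i * (u i - u (i + 1)))"
    using n' by (intro sum.cong) (auto simp: symm_def cm \<beta>m)
  also have "\<beta> 0 * 2 * c 0 + (\<Sum>i\<in>{1..n'}. B i * (u i - u (i + 1))) + \<beta> n * 2 * c n
      = - B 0 * u 1 + (\<Sum>i\<in>{1..n'}. B i * (u i - u (i + 1))) + B (n' + 1) * u (n' + 1)"
    unfolding Suc_eq_plus1[symmetric] n'[symmetric] c0 cn using \<beta>0 \<beta>n by (simp add: mult.commute[of _ 2])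
  also have "\<dots> = (\<Sum>i\<in>{1..n' + 1}. u i * u i)"
    by (rule sum_by_parts_squares) (rule B)
  also have "\<dots> = (\<Sum>i\<in>{1..n}. (if i = a then \<sigma> * u i else 0) + (if i = b then \<tau> * u i else 0))"
    using n' by (intro sum.cong) (auto simp: u_def algebra_simps)
  also have "\<dots> = \<sigma> * u a + \<tau> * u b"
    using i(1,2) by (simp add: sum.distrib)
  also have "\<dots> = (if a = b then 4 else 2)"
    using i(3-5) by (auto simp: u_def)
  finally show ?thesis .
qed

section \<open>Similarity of strings\<close>

lemma similar_letter_fst: "similar_letter u v \<Longrightarrow> fst u = fst v"
  by (auto simp: similar_letter_def letter_inv_def)

lemma similar_letter_ends:
  "similar_letter u v \<Longrightarrow> lsrc \<Omega> u = lsrc \<Omega> v" "similar_letter u v \<Longrightarrow> ltgt \<Omega> u = ltgt \<Omega> v"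
  by (auto simp: similar_letter_def letter_inv_def lsrc_def ltgt_def split: sign.splits)

lemma flip_flip: "flip (flip \<sigma>) = \<sigma>"
  by (cases \<sigma>) auto

lemma letter_inv_inv: "letter_inv (letter_inv u) = u"
  by (simp add: letter_inv_def flip_flip)

lemma similar_letter_refl: "similar_letter u u"
  by (simp add: similar_letter_def)

lemma similar_letter_sym: "similar_letter u v \<longleftrightarrow> similar_letter v u"
  by (auto simp: similar_letter_def letter_inv_inv) (auto simp: letter_inv_def)

lemma similar_letter_trans: "similar_letter u v \<Longrightarrow> similar_letter v w \<Longrightarrow> similar_letter u w"
  by (auto simp: similar_letter_def letter_inv_inv)

lemma similar_letter_inv: "similar_letter u v \<Longrightarrow> similar_letter (letter_inv u) (letter_inv v)"
  by (auto simp: similar_letter_def letter_inv_def)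

text \<open>The two signs exhaust the letters of an arrow, so the two inequalities in the definition say
  that the arrows differ.\<close>

lemma linkable_iff: "linkable \<Omega> u v \<longleftrightarrow> lsrc \<Omega> u = ltgt \<Omega> v \<and> fst u \<noteq> fst v"
proof -
  have "snd u = snd v \<or> snd u = flip (snd v)" by (cases "snd u"; cases "snd v") auto
  then show ?thesis by (auto simp: linkable_def letter_inv_def prod_eq_iff)
qed

lemma same_arrow_ends:
  assumes "fst u = fst v"
  shows "ltgt \<Omega> u = ltgt \<Omega> v \<and> lsrc \<Omega> u = lsrc \<Omega> v \<or> ltgt \<Omega> u = lsrc \<Omega> v \<and> lsrc \<Omega> u = ltgt \<Omega> v"
  using assms by (cases "snd u"; cases "snd v") (simp_all add: ltgt_def lsrc_def)

lemma similar_refl: "similar w w"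
  by (cases w) (auto simp: list_all2_refl similar_letter_refl)

lemma similar_sym: "similar v w \<Longrightarrow> similar w v"
  by (cases v; cases w) (auto simp: list_all2_conv_all_nth similar_letter_sym)

lemma similar_trans: "similar u v \<Longrightarrow> similar v w \<Longrightarrow> similar u w"
proof (cases u; cases v; cases w)
  fix us vs ws
  assume "similar u v" "similar v w" and [simp]: "u = Word us" "v = Word vs" "w = Word ws"
  then show "similar u w"
    using list_all2_trans[of similar_letter similar_letter similar_letter us vs ws] similar_letter_trans
    by simp
qed auto

lemma similar_str_length: "similar v w \<Longrightarrow> str_length v = str_length w"
  by (cases v; cases w) (auto dest: list_all2_lengthD)

lemma similar_str_inv: "similar v w \<Longrightarrow> similar (str_inv v) (str_inv w)"
  by (cases v; cases w) (auto simp: list_all2_map1 list_all2_map2 similar_letter_inv elim: list_all2_mono)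

text \<open>A loop and its inverse have the same source and the same target, so similar strings visit
  the same vertices; hence rank and local freeness are invariants of similarity classes.\<close>

lemma similar_word_ends:
  assumes "list_all2 similar_letter us vs"
  shows "map (ltgt \<Omega>) us = map (ltgt \<Omega>) vs" "us \<noteq> [] \<Longrightarrow> similar_letter (last us) (last vs)"
    "us \<noteq> [] \<Longrightarrow> similar_letter (hd us) (hd vs)"
proof -
  show "map (ltgt \<Omega>) us = map (ltgt \<Omega>) vs"
    using assms by (induction rule: list_all2_induct) (auto simp: similar_letter_ends)
  show "us \<noteq> [] \<Longrightarrow> similar_letter (hd us) (hd vs)"
    using assms by (cases us; cases vs) auto
  show "us \<noteq> [] \<Longrightarrow> similar_letter (last us) (last vs)"
    using assms list_all2_lengthD[OF assms] by (cases "vs = []") (auto simp: list_all2_conv_all_nth last_conv_nth)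
qed

lemma similar_vertex_seq:
  assumes "similar v w" "is_string n \<Omega> v"
  shows "vertex_seq \<Omega> v = vertex_seq \<Omega> w"
  using assms by (cases v; cases w) (auto simp: similar_word_ends similar_letter_ends)

lemma similar_rk: "similar v w \<Longrightarrow> is_string n \<Omega> v \<Longrightarrow> rk n \<Omega> v = rk n \<Omega> w"
  by (simp add: rk_def similar_vertex_seq fun_eq_iff)

lemma similar_loc_free:
  assumes "similar v w" "is_string n \<Omega> v"
  shows "loc_free n \<Omega> v \<longleftrightarrow> loc_free n \<Omega> w"
proof (cases v; cases w)
  fix vs ws assume [simp]: "v = Word vs" "w = Word ws"
  have l: "list_all2 similar_letter vs ws" and ne: "vs \<noteq> []" using assms by auto
  show ?thesis
    using similar_word_ends(2,3)[OF l ne] by (simp add: similar_letter_ends similar_letter_fst)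
qed (use assms in auto)

lemma sim_class_similar: "similar v w \<Longrightarrow> sim_class n \<Omega> v = sim_class n \<Omega> w"
  unfolding sim_class_def using similar_trans similar_sym by blast

section \<open>The folded line\<close>

text \<open>The integers are the positions of a line that is folded onto the path. The edge from \<open>x\<close> to
  \<open>x + 1\<close> carries a letter which is read when walking to the right.\<close>

locale walks =
  fixes n :: nat and \<Omega> :: "(nat \<times> nat) set"
  assumes n2: "n \<ge> 2"
begin

definition period :: int where
  "period = 2 * (int n + 1)"

lemma half_period_dvd: "int n + 1 dvd period * m"
  unfolding period_def by (rule dvd_mult2, rule dvd_triv_right)

lemma period_pos: "period > 0" "period > 2 * int n + 1"
  by (simp_all add: period_def)

lemma even_period: "2 dvd period"
  by (simp add: period_def)

lemma dvd_period_small: "period dvd x \<Longrightarrow> \<bar>x\<bar> < period \<Longrightarrow> x = 0"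
  using zdvd_not_zless[of "\<bar>x\<bar>" period] by force

lemma mod_period_bounds: "0 \<le> x mod period" "x mod period < period"
  using period_pos by simp_all

lemma mod_period_eqI: "x = period * m + r \<Longrightarrow> 0 \<le> r \<Longrightarrow> r < period \<Longrightarrow> x mod period = r"
  by (rule int_mod_pos_eq)

lemma div_period_eqI: "x = period * m + r \<Longrightarrow> 0 \<le> r \<Longrightarrow> r < period \<Longrightarrow> x div period = m"
  by (rule int_div_pos_eq)

lemma div_period_step: "(y + 1) div period = y div period + (if period dvd y + 1 then 1 else 0)"
proof (cases "period dvd y + 1")
  case True
  then obtain q where q: "y + 1 = period * q" by blast
  have "y div period = q - 1"
    using q period_pos by (intro int_div_pos_eq[of _ _ _ "period - 1"]) (auto simp: algebra_simps)
  then show ?thesis using q period_pos True by simp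
next
  case False
  have y: "y = period * (y div period) + y mod period" by simp
  have "y mod period + 1 \<noteq> period"
  proof
    assume "y mod period + 1 = period"
    then have "y + 1 = period * (y div period) + period" using y by linarith
    then show False using False by simp
  qed
  then have "(y + 1) div period = y div period"
    using y mod_period_bounds[of y] by (intro int_div_pos_eq[of _ _ _ "y mod period + 1"]) auto
  then show ?thesis using False by simp
qed

text \<open>The positions \<open>0, \<dots>, n\<close> of a period run up the path and the positions \<open>n + 1, \<dots>, 2 n + 1\<close> run
  down again.\<close>

definition vert :: "int \<Rightarrow> nat" where
  "vert x = nat (if x mod period \<le> int n then x mod period else period - 1 - x mod period)"

text \<open>On the way up from \<open>k - 1\<close> to \<open>k\<close> the letter is \<open>\<eta>\<^sub>k\<close> if this arrow points down, since letters go
  from target to source; on the way down it is the opposite letter. Between the two halves of a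
  period the walk passes a loop. Loops are taken with sign \<open>Neg\<close> to make the strings \<open>r\<^sub>i\<close>,
  which are inverse strings, literally equal to walks.\<close>

definition edge :: "int \<Rightarrow> letter" where
  "edge x = (let r = x mod period; k = nat (period - 1 - r) in
     if r < int n then (Eta (nat r + 1), if (nat r, nat r + 1) \<in> \<Omega> then Pos else Neg)
     else if r = int n then (Eps n, Neg)
     else if r < period - 1 then (Eta k, if (k - 1, k) \<in> \<Omega> then Neg else Pos)
     else (Eps 0, Neg))"

lemma edge_position_cases:
  obtains (up) m k where "k \<in> {1..n}" "x = period * m + int k - 1"
    | (top) m where "x = period * m + int n"
    | (down) m k where "k \<in> {1..n}" "x = period * m - int k - 1"
    | (bottom) m where "x = period * m - 1"
proof -
  define r m where "r = x mod period" and "m = x div period"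
  have x: "x = period * m + r" and r: "0 \<le> r" "r < period"
    using period_pos by (simp_all add: r_def m_def)
  consider "r < int n" | "r = int n" | "int n < r" "r < period - 1" | "r = period - 1"
    using r by linarith
  then show thesis
  proof cases
    case 1
    then show thesis using up[of "nat r + 1" m] x r by simp
  next
    case 2
    then show thesis using top x by blast
  next
    case 3
    then have "nat (period - 1 - r) \<in> {1..n}" "int (nat (period - 1 - r)) = period - 1 - r"
      using period_def by auto
    then show thesis
      using down[of "nat (period - 1 - r)" "m + 1"] x by (simp add: algebra_simps)
  next
    case 4
    then show thesis using bottom[of "m + 1"] x by (simp add: algebra_simps)
  qed
qed

lemma vert_up: "i \<le> n \<Longrightarrow> vert (period * m + int i) = i"
  using mod_period_eqI[of "period * m + int i" m "int i"] period_pos by (simp add: vert_def)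

lemma vert_down: "i \<le> n \<Longrightarrow> vert (period * m - int i - 1) = i"
  using mod_period_eqI[of "period * m - int i - 1" "m - 1" "period - int i - 1"] period_pos
  by (simp add: vert_def algebra_simps)

lemma edge_up:
  assumes "k \<in> {1..n}"
  shows "edge (period * m + int k - 1) = (Eta k, if (k - 1, k) \<in> \<Omega> then Pos else Neg)"
  using mod_period_eqI[of "period * m + int k - 1" m "int k - 1"] period_pos assms
  by (simp add: edge_def nat_diff_distrib)

lemma edge_top: "edge (period * m + int n) = (Eps n, Neg)"
  using mod_period_eqI[of "period * m + int n" m "int n"] period_pos by (simp add: edge_def)

lemma edge_down:
  assumes "k \<in> {1..n}"
  shows "edge (period * m - int k - 1) = (Eta k, if (k - 1, k) \<in> \<Omega> then Neg else Pos)"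
proof -
  have "(period * m - int k - 1) mod period = period - int k - 1"
    using mod_period_eqI[of _ "m - 1" "period - int k - 1"] period_pos assms
    by (simp add: algebra_simps)
  then show ?thesis using period_pos assms by (simp add: edge_def)
qed

lemma edge_bottom: "edge (period * m - 1) = (Eps 0, Neg)"
  using mod_period_eqI[of "period * m - 1" "m - 1" "period - 1"] period_pos
  by (simp add: edge_def algebra_simps)

lemmas edge_simps = edge_up edge_top edge_down edge_bottom

lemma vert_le: "vert x \<le> n"
  using period_def by (auto simp: vert_def)

lemma vert_edge: "ltgt \<Omega> (edge x) = vert x" "lsrc \<Omega> (edge x) = vert (x + 1)"
proof -
  have "ltgt \<Omega> (edge x) = vert x \<and> lsrc \<Omega> (edge x) = vert (x + 1)"
  proof (cases x rule: edge_position_cases)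
    case (up m k)
    then show ?thesis
      using vert_up[of "k - 1" m] vert_up[of k m] edge_up[of k m]
      by (auto simp: ltgt_def lsrc_def of_nat_diff diff_diff_eq2 add_diff_eq)
  next
    case (top m)
    then show ?thesis
      using vert_up[of n m] vert_down[of n "m + 1"] edge_top[of m]
      by (simp add: ltgt_def lsrc_def period_def algebra_simps)
  next
    case (down m k)
    then show ?thesis
      using vert_down[of "k - 1" m] vert_down[of k m] edge_down[of k m]
      by (auto simp: ltgt_def lsrc_def of_nat_diff diff_diff_eq2 add_diff_eq)
  next
    case (bottom m)
    then show ?thesis
      using vert_up[of 0 m] vert_down[of 0 m] edge_bottom[of m]
      by (simp add: ltgt_def lsrc_def)
  qed
  then show "ltgt \<Omega> (edge x) = vert x" "lsrc \<Omega> (edge x) = vert (x + 1)" by simp_all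
qed

lemma edge_in_arrows: "fst (edge x) \<in> arrows n"
  by (cases x rule: edge_position_cases) (auto simp: edge_simps arrows_def)

lemma vert_period: "period dvd x - y \<Longrightarrow> vert x = vert y"
  by (metis mod_eq_dvd_iff vert_def)

lemma edge_period: "period dvd x - y \<Longrightarrow> edge x = edge y"
  by (metis mod_eq_dvd_iff edge_def)

lemma vert_eq_iff: "i \<le> n \<Longrightarrow> vert x = i \<longleftrightarrow> period dvd x - int i \<or> period dvd x + int i + 1"
proof -
  assume i: "i \<le> n"
  have "vert x = i" if "period dvd x - int i"
    using vert_period[OF that] vert_up[OF i, of 0] by simp
  moreover have "vert x = i" if "period dvd x + int i + 1"
    using vert_period[of x "- int i - 1"] vert_down[OF i, of 0] that by (simp add: algebra_simps)
  moreover have "period dvd x - int i \<or> period dvd x + int i + 1" if "vert x = i"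
  proof (cases "x mod period \<le> int n")
    case True
    then have "x mod period = int i" using that period_pos by (auto simp: vert_def)
    then show ?thesis using minus_mod_eq_mult_div[of x period] by simp
  next
    case False
    then have r: "x mod period = period - 1 - int i" 
      using that period_pos pos_mod_bound[of period x] by (auto simp: vert_def)
    have "period dvd x - x mod period + period" by simp
    also have "x - x mod period + period = x + int i + 1" unfolding r by simp
    finally show ?thesis ..
  qed
  ultimately show ?thesis by blast
qed

text \<open>The fibres of the folding are the orbits of the group generated by \<open>x \<mapsto> x + period\<close> and
  \<open>x \<mapsto> - 1 - x\<close>.\<close>

lemma vert_eq_vert_iff: "vert x = vert y \<longleftrightarrow> period dvd x - y \<or> period dvd x + y + 1"
proof -
  have y: "period dvd y - int (vert y) \<or> period dvd y + int (vert y) + 1"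
    using vert_eq_iff[OF vert_le[of y], of y] by simp
  have *: "period dvd x - a \<or> period dvd x + a + 1 \<longleftrightarrow> period dvd x - b \<or> period dvd x + b + 1"
    if "period dvd b - a \<or> period dvd b + a + 1" for a b :: int
    using that
  proof
    assume "period dvd b - a"
    then have "period dvd x - a \<longleftrightarrow> period dvd x - b" "period dvd x + a + 1 \<longleftrightarrow> period dvd x + b + 1"
      using dvd_add_right_iff[of period "b - a" "x - b"] dvd_add_right_iff[of period "b - a" "x + a + 1"]
      by (simp_all add: algebra_simps)
    then show ?thesis by simp
  next
    assume "period dvd b + a + 1"
    then have "period dvd x - a \<longleftrightarrow> period dvd x + b + 1" "period dvd x + a + 1 \<longleftrightarrow> period dvd x - b"
      using dvd_add_right_iff[of period "b + a + 1" "x - a"] dvd_add_right_iff[of period "b + a + 1" "x - b"]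
      by (simp_all add: algebra_simps)
    then show ?thesis by blast
  qed
  show ?thesis using vert_eq_iff[OF vert_le[of y], of x] *[of y "int (vert y)"] y by simp
qed

text \<open>The reflection exchanges \<open>x\<close> and \<open>x + 1\<close> with \<open>- 1 - x\<close> and \<open>- 2 - x\<close>, so it reverses the edge
  at \<open>x\<close>.\<close>

lemma edge_reflect: "similar_letter (letter_inv (edge x)) (edge (- 2 - x))"
proof (cases x rule: edge_position_cases)
  case (up m k)
  have *: "- 2 - x = period * (- m) - int k - 1" using up by simp
  show ?thesis
    unfolding * unfolding up(2) edge_up[OF up(1)] edge_down[OF up(1)]
    by (simp add: similar_letter_def letter_inv_def)
next
  case (top m)
  have *: "- 2 - x = period * (- m - 1) + int n" using top by (simp add: algebra_simps period_def)
  show ?thesis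
    unfolding * unfolding top edge_top by (simp add: similar_letter_def letter_inv_def)
next
  case (down m k)
  have *: "- 2 - x = period * (- m) + int k - 1" using down by simp
  show ?thesis
    unfolding * unfolding down(2) edge_up[OF down(1)] edge_down[OF down(1)]
    by (simp add: similar_letter_def letter_inv_def)
next
  case (bottom m)
  have *: "- 2 - x = period * (- m) - 1" using bottom by simp
  show ?thesis
    unfolding * unfolding bottom edge_bottom by (simp add: similar_letter_def letter_inv_def)
qed

text \<open>Edges with the same arrow have the same pair of end vertices, and this leaves only the two
  ways in which an edge can be mapped to another by the folding group.\<close>

lemma fst_edge_eq_iff: "fst (edge x) = fst (edge y) \<longleftrightarrow> period dvd x - y \<or> period dvd x + y + 2"
proof
  assume "period dvd x - y \<or> period dvd x + y + 2"
  then show "fst (edge x) = fst (edge y)"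
  proof
    assume "period dvd x + y + 2"
    then have "period dvd x - (- 2 - y)" by (simp add: algebra_simps)
    then have "edge x = edge (- 2 - y)" by (rule edge_period)
    then show ?thesis
      using similar_letter_fst[OF edge_reflect[of y]] by (simp add: letter_inv_def)
  qed (simp add: edge_period)
next
  assume "fst (edge x) = fst (edge y)"
  then have "vert x = vert y \<and> vert (x + 1) = vert (y + 1) \<or> vert x = vert (y + 1) \<and> vert (x + 1) = vert y"
    using same_arrow_ends[of "edge x" "edge y" \<Omega>] by (simp add: vert_edge)
  then consider "period dvd x - y" | "period dvd x + y + 2" | "period dvd x + y + 1" "period dvd x + y + 3"
    | "period dvd x - y - 1" "period dvd x - y + 1"
    by (auto simp: vert_eq_vert_iff algebra_simps)
  moreover have "\<not> (period dvd a \<and> period dvd b)" if "b - a = 2" for a b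
    using dvd_diff[of period b a] that dvd_period_small[of 2] period_pos n2 by auto
  from this[of "x + y + 3" "x + y + 1"] this[of "x - y + 1" "x - y - 1"]
  have "\<not> (period dvd x + y + 1 \<and> period dvd x + y + 3)" "\<not> (period dvd x - y - 1 \<and> period dvd x - y + 1)"
    by simp_all
  ultimately show "period dvd x - y \<or> period dvd x + y + 2" by blast
qed

text \<open>The letter after the one at \<open>x\<close> starts at a position over the same vertex as \<open>x + 1\<close>. There
  are two such positions up to the period: \<open>x + 1\<close>, and \<open>- 2 - x\<close>, whose edge has the same arrow as \<open>x\<close>.
  So there is no choice but to go on to the right.\<close>

lemma linkable_edge_iff:
  assumes "similar_letter u (edge x)" "similar_letter v (edge y)"
  shows "linkable \<Omega> u v \<longleftrightarrow> period dvd y - (x + 1)"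
proof -
  have "linkable \<Omega> u v \<longleftrightarrow> vert (x + 1) = vert y \<and> fst (edge x) \<noteq> fst (edge y)"
    using assms by (simp add: linkable_iff similar_letter_ends similar_letter_fst vert_edge)
  also have "\<dots> \<longleftrightarrow> (period dvd x + 1 - y \<or> period dvd x + y + 2) \<and> \<not> (period dvd x - y \<or> period dvd x + y + 2)"
    by (simp add: vert_eq_vert_iff fst_edge_eq_iff algebra_simps)
  also have "\<dots> \<longleftrightarrow> period dvd x + 1 - y"
  proof -
    have "\<not> period dvd x - y" if "period dvd x + 1 - y"
    proof
      assume "period dvd x - y"
      then have "period dvd (x + 1 - y) - (x - y)" using that by (rule dvd_diff[rotated])
      then show False using period_pos n2 by (simp add: zdvd_not_zless)
    qed
    moreover have "\<not> period dvd x + y + 2" if "period dvd x + 1 - y"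
    proof
      assume "period dvd x + y + 2"
      then have "even (x + y + 2)" "even (x + 1 - y)" using that even_period dvd_trans by blast+
      then show False by presburger
    qed
    ultimately show ?thesis by blast
  qed
  finally show ?thesis by (metis dvd_minus_iff minus_diff_eq)
qed

lemma letter_position:
  assumes "fst u \<in> arrows n"
  shows "\<exists>x. similar_letter u (edge x)"
proof -
  obtain a \<sigma> where u: "u = (a, \<sigma>)" by (cases u)
  consider "a = Eps 0" | "a = Eps n" | k where "a = Eta k" "k \<in> {1..n}"
    using assms u by (auto simp: arrows_def)
  then show ?thesis
  proof cases
    case 1
    then show ?thesis using u edge_bottom[of 0]
      by (intro exI[of _ "-1"]) (cases \<sigma>; simp add: similar_letter_def letter_inv_def)
  next
    case 2
    then show ?thesis using u edge_top[of 0]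
      by (intro exI[of _ "int n"]) (cases \<sigma>; simp add: similar_letter_def letter_inv_def)
  next
    case 3
    then show ?thesis
      using u edge_up[OF 3(2), of 0] edge_down[OF 3(2), of 0]
      by (cases "\<sigma> = snd (edge (int k - 1))"; cases \<sigma>)
        (auto simp: similar_letter_def intro: exI[of _ "int k - 1"] exI[of _ "- int k - 1"] split: if_splits)
  qed
qed

lemma similar_edge_iff: "similar_letter (edge x) (edge y) \<longleftrightarrow> period dvd x - y"
proof
  assume s: "similar_letter (edge x) (edge y)"
  have "vert x = vert y" using similar_letter_ends(2)[OF s, of \<Omega>] by (simp add: vert_edge)
  moreover have "fst (edge x) = fst (edge y)" by (rule similar_letter_fst[OF s])
  ultimately have "period dvd x - y \<or> period dvd x + y + 1 \<and> period dvd x + y + 2"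
    by (auto simp: vert_eq_vert_iff fst_edge_eq_iff)
  moreover have False if "period dvd x + y + 1" "period dvd x + y + 2"
    using dvd_diff[OF that(2,1)] period_pos n2 by (simp add: zdvd_not_zless)
  ultimately show "period dvd x - y" by blast
qed (simp add: edge_period similar_letter_refl)

section \<open>Strings as walks on the line\<close>

text \<open>A trivial string with sign \<open>Pos\<close> continues upwards and with sign \<open>Neg\<close> downwards, which is the
  direction at a position in the first or second half of a period.\<close>

definition walk :: "int \<Rightarrow> nat \<Rightarrow> qstring" where
  "walk p l = (if l = 0 then Triv (vert p) (if p mod period \<le> int n then Pos else Neg)
     else Word (map (\<lambda>j. edge (p + int j)) [0..<l]))"

lemma walk_0: "walk p 0 = Triv (vert p) (if p mod period \<le> int n then Pos else Neg)"
  by (simp add: walk_def)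

lemma walk_pos: "l > 0 \<Longrightarrow> walk p l = Word (map (\<lambda>j. edge (p + int j)) [0..<l])"
  by (simp add: walk_def)

lemma str_length_walk: "str_length (walk p l) = l"
  by (simp add: walk_def)

lemma walk_period: "period dvd p - q \<Longrightarrow> walk p l = walk q l"
proof -
  assume a: "period dvd p - q"
  then have "edge (p + j) = edge (q + j)" for j by (intro edge_period) simp
  moreover have "vert p = vert q" "p mod period = q mod period"
    using a by (simp_all add: vert_period mod_eq_dvd_iff)
  ultimately show ?thesis by (simp add: walk_def)
qed

lemma is_string_walk: "is_string n \<Omega> (walk p l)"
proof (cases "l = 0")
  case True
  then show ?thesis by (simp add: walk_0 vert_le)
next
  case False
  have "linkable \<Omega> (edge x) (edge (x + 1))" for x
    using linkable_edge_iff[of "edge x" x "edge (x + 1)" "x + 1"] by (simp add: similar_letter_refl)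
  then have "linkable \<Omega> (edge (p + int j)) (edge (p + int (Suc j)))" for j
    by (metis add.assoc of_nat_Suc add.commute)
  then show ?thesis
    using False edge_in_arrows by (auto simp: walk_pos successively_conv_nth)
qed

lemma word_similar_walk:
  assumes "is_string n \<Omega> (Word ws)" "similar_letter (hd ws) (edge p)"
  shows "similar (Word ws) (walk p (length ws))"
proof -
  have ne: "ws \<noteq> []" and arr: "\<forall>u\<in>set ws. fst u \<in> arrows n" and suc: "successively (linkable \<Omega>) ws"
    using assms(1) by auto
  have "similar_letter (ws ! j) (edge (p + int j))" if "j < length ws" for j
    using that
  proof (induction j)
    case 0
    then show ?case using assms(2) ne by (simp add: hd_conv_nth)
  next
    case (Suc j)
    have "ws ! Suc j \<in> set ws" using Suc.prems by simp
    then obtain y where y: "similar_letter (ws ! Suc j) (edge y)" using arr letter_position by blast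
    have "linkable \<Omega> (ws ! j) (ws ! Suc j)" using suc Suc.prems by (simp add: successively_conv_nth)
    then have "period dvd y - (p + int j + 1)" using linkable_edge_iff[OF _ y] Suc by simp
    then have "edge y = edge (p + int (Suc j))" by (intro edge_period) (simp add: algebra_simps)
    then show ?case using y by simp
  qed
  then show ?thesis using ne by (simp add: walk_pos list_all2_conv_all_nth)
qed

lemma similar_walk_exists:
  assumes "is_string n \<Omega> w"
  shows "\<exists>p. similar w (walk p (str_length w))"
proof (cases w)
  case (Word ws)
  then have "fst (hd ws) \<in> arrows n" using assms by simp
  then obtain p where "similar_letter (hd ws) (edge p)" using letter_position by blast
  then show ?thesis using word_similar_walk assms Word by fastforce
next
  case (Triv i \<sigma>)
  then have i: "i \<le> n" using assms by simp
  have "int i mod period = int i" "(- int i - 1) mod period = period - 1 - int i"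
    using i period_pos mod_period_eqI[of "- int i - 1" "- 1" "period - 1 - int i"] by auto
  then show ?thesis
    using Triv vert_up[OF i, of 0] vert_down[OF i, of 0] i period_pos
    by (cases \<sigma>) (auto simp: walk_0 intro: exI[of _ "int i"] exI[of _ "- int i - 1"])
qed

lemma similar_walk_iff: "similar (walk p l) (walk q m) \<longleftrightarrow> l = m \<and> period dvd p - q"
proof
  assume s: "similar (walk p l) (walk q m)"
  then have lm: "l = m" using similar_str_length str_length_walk by metis
  show "l = m \<and> period dvd p - q"
  proof (cases "l = 0")
    case True
    then have v: "vert p = vert q" and side: "p mod period \<le> int n \<longleftrightarrow> q mod period \<le> int n"
      using s lm by (auto simp: walk_0 split: if_splits)
    have "nat a = nat b \<Longrightarrow> a = b" if "0 \<le> a" "0 \<le> b" for a b using that by simp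
    then have "p mod period = q mod period"
      using v side mod_period_bounds[of p] mod_period_bounds[of q]
      unfolding vert_def by (smt (verit))
    then show ?thesis using lm by (simp add: mod_eq_dvd_iff)
  next
    case False
    then have "similar_letter (edge p) (edge q)"
      using s lm by (auto simp: walk_pos list_all2_conv_all_nth dest: spec[of _ 0])
    then show ?thesis using lm by (simp add: similar_edge_iff)
  qed
next
  assume a: "l = m \<and> period dvd p - q"
  then have "walk p l = walk q l" by (intro walk_period) simp
  then show "similar (walk p l) (walk q m)" using a by (simp add: similar_refl)
qed

lemma str_inv_walk: "similar (str_inv (walk p l)) (walk (- (p + int l + 1)) l)"
proof (cases "l = 0")
  case True
  have p: "(- (p + 1)) mod period = period - 1 - p mod period"
    using mod_period_eqI[of "- (p + 1)" "- (p div period) - 1" "period - 1 - p mod period"] mod_period_bounds[of p]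
    by (simp add: algebra_simps)
  have "vert (- (p + 1)) = vert p" using vert_eq_vert_iff[of "- (p + 1)" p] by simp
  moreover have "(- (p + 1)) mod period \<le> int n \<longleftrightarrow> \<not> p mod period \<le> int n"
    unfolding p using period_def by auto
  ultimately show ?thesis using True by (simp add: walk_0)
next
  case False
  have "similar_letter (letter_inv (edge (p + int (l - Suc j)))) (edge (- (p + int l + 1) + int j))"
    if "j < l" for j
    using edge_reflect[of "p + int (l - Suc j)"] that by (simp add: of_nat_diff algebra_simps)
  then show ?thesis
    using False by (simp add: walk_pos list_all2_conv_all_nth rev_nth)
qed

lemma vertex_seq_walk: "vertex_seq \<Omega> (walk p l) = map (\<lambda>j. vert (p + int j)) [0..<Suc l]"
proof (cases "l = 0")
  case False
  then have "last (map (\<lambda>j. edge (p + int j)) [0..<l]) = edge (p + int (l - 1))"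
    by (simp add: last_map)
  moreover have "p + int (l - 1) + 1 = p + int l" using False by simp
  ultimately show ?thesis using False by (simp add: walk_pos vert_edge comp_def)
qed (simp add: walk_0)

lemma sim_class_walk_eq_iff:
  "sim_class n \<Omega> (walk p l) = sim_class n \<Omega> (walk q m) \<longleftrightarrow> l = m \<and> period dvd p - q"
proof
  assume "sim_class n \<Omega> (walk p l) = sim_class n \<Omega> (walk q m)"
  moreover have "walk q m \<in> sim_class n \<Omega> (walk q m)"
    by (simp add: sim_class_def is_string_walk similar_refl)
  ultimately have "walk q m \<in> sim_class n \<Omega> (walk p l)" by (simp only:)
  then have "similar (walk p l) (walk q m)" by (simp add: sim_class_def)
  then show "l = m \<and> period dvd p - q" by (simp only: similar_walk_iff)
next
  assume "l = m \<and> period dvd p - q"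
  then have "similar (walk p l) (walk q m)" by (simp only: similar_walk_iff)
  then show "sim_class n \<Omega> (walk p l) = sim_class n \<Omega> (walk q m)" by (rule sim_class_similar)
qed

lemma in_sim_class_walk: "v \<in> sim_class n \<Omega> (walk p l) \<longleftrightarrow> is_string n \<Omega> v \<and> similar v (walk p l)"
  unfolding sim_class_def by (auto intro: similar_sym)

lemma sim_class_walk_disjoint:
  assumes "\<not> period dvd p - q"
  shows "sim_class n \<Omega> (walk p l) \<inter> sim_class n \<Omega> (walk q m) = {}"
proof (rule equals0I)
  fix v assume "v \<in> sim_class n \<Omega> (walk p l) \<inter> sim_class n \<Omega> (walk q m)"
  then have "similar v (walk p l)" "similar v (walk q m)" by (simp_all add: in_sim_class_walk)
  then have "similar (walk p l) (walk q m)" by (rule similar_trans[OF similar_sym])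
  then show False using assms by (simp add: similar_walk_iff)
qed

section \<open>Local freeness\<close>

text \<open>The positions that a walk reaches through a loop. A locally free walk neither starts at such a
  position nor has one as the first position behind it.\<close>

definition cut :: "int \<Rightarrow> bool" where
  "cut x \<longleftrightarrow> int n + 1 dvd x"

lemma cut_minus: "cut (- x) \<longleftrightarrow> cut x"
  by (simp add: cut_def)

lemma cut_period: "period dvd p - q \<Longrightarrow> cut p \<longleftrightarrow> cut q"
proof -
  assume "period dvd p - q"
  then have "int n + 1 dvd p - q" using half_period_dvd[of 1] by (simp only: mult_1_right) (rule dvd_trans)
  then have "int n + 1 dvd (p - q) + q \<longleftrightarrow> int n + 1 dvd q" by (rule dvd_add_right_iff)
  then show ?thesis by (simp add: cut_def)
qed

lemma cut_iff: "cut x \<longleftrightarrow> period dvd x \<or> period dvd x + (int n + 1)"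
proof -
  let ?N = "int n + 1"
  have p: "period = 2 * ?N" by (simp add: period_def)
  have "?N dvd x" if "period dvd x \<or> period dvd x + ?N"
  proof -
    have "?N dvd period" unfolding p by (rule dvd_triv_right)
    then have "?N dvd x \<or> ?N dvd x + ?N" using that dvd_trans by blast
    then show ?thesis by (simp only: dvd_add_triv_right_iff disj_absorb)
  qed
  moreover have "period dvd x \<or> period dvd x + ?N" if "?N dvd x"
  proof -
    obtain c where c: "x = ?N * c" using \<open>?N dvd x\<close> by blast
    show ?thesis
    proof (cases "even c")
      case True
      then have "2 * ?N dvd c * ?N" by (intro mult_dvd_mono) auto
      then show ?thesis unfolding c p by (simp only: mult.commute[of ?N c] simp_thms)
    next
      case False
      then have "even (c + 1)" by simp
      then have "2 * ?N dvd (c + 1) * ?N" by (intro mult_dvd_mono) auto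
      then show ?thesis unfolding c p by (simp add: algebra_simps)
    qed
  qed
  ultimately show ?thesis by (auto simp: cut_def)
qed

lemma vert_0_or_n: "vert x \<in> {0, n} \<longleftrightarrow> cut x \<or> cut (x + 1)"
proof -
  have "x - int n + period = x + (int n + 2)" by (simp add: period_def)
  then have "period dvd x - int n \<longleftrightarrow> period dvd x + (int n + 2)" by (metis dvd_add_triv_right_iff)
  then show ?thesis by (auto simp: cut_iff vert_eq_iff algebra_simps)
qed

lemma edge_Eps: "(\<exists>i. fst (edge x) = Eps i) \<longleftrightarrow> cut (x + 1)"
  "fst (edge x) = Eps i \<Longrightarrow> vert x = i \<and> vert (x + 1) = i"
proof -
  have "vert (x + 1) = vert x \<longleftrightarrow> cut (x + 1)"
  proof -
    have "\<not> period dvd 1" using period_pos n2 by simp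
    moreover have "x + 1 + x + 1 = 2 * (x + 1)" by simp
    moreover have "period dvd 2 * (x + 1) \<longleftrightarrow> int n + 1 dvd x + 1"
      by (simp only: period_def dvd_mult_cancel_left, simp)
    ultimately show ?thesis unfolding vert_eq_vert_iff cut_def by (simp add: add.commute)
  qed
  moreover have "vert (x + 1) = vert x \<and> vert x = i" if "fst (edge x) = Eps i" for i
    using that vert_edge[of x] by (cases "snd (edge x)") (auto simp: ltgt_def lsrc_def)
  moreover have "vert (x + 1) \<noteq> vert x" if "fst (edge x) = Eta i" for i
  proof -
    have "i \<in> {1..n}" using edge_in_arrows[of x] that by (auto simp: arrows_def)
    then show ?thesis
      using that vert_edge[of x] by (cases "snd (edge x)") (auto simp: ltgt_def lsrc_def split: if_splits)
  qed
  ultimately show "(\<exists>i. fst (edge x) = Eps i) \<longleftrightarrow> cut (x + 1)" 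
    "fst (edge x) = Eps i \<Longrightarrow> vert x = i \<and> vert (x + 1) = i"
    by (metis arrow.exhaust)+
qed

text \<open>At a position over \<open>0\<close> or \<open>n\<close> there is a loop on exactly one side. The walk must pass
  it, so it may not start just behind a loop or stop just before one.\<close>

lemma loc_free_walk: "loc_free n \<Omega> (walk p l) \<longleftrightarrow> \<not> cut p \<and> \<not> cut (p + int l + 1)"
proof (cases "l = 0")
  case True
  then show ?thesis using vert_0_or_n[of p] by (simp add: walk_0)
next
  case False
  let ?e = "p + int (l - 1)"
  have e: "?e + 1 = p + int l" using False by simp
  have "last (map (\<lambda>j. edge (p + int j)) [0..<l]) = edge ?e" "hd (map (\<lambda>j. edge (p + int j)) [0..<l]) = edge p"
    using False by (simp_all add: last_map hd_map)
  then have "loc_free n \<Omega> (walk p l) \<longleftrightarrow>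
     (vert (?e + 1) \<in> {0, n} \<longrightarrow> fst (edge ?e) = Eps (vert (?e + 1))) \<and>
     (vert p \<in> {0, n} \<longrightarrow> fst (edge p) = Eps (vert p))"
    using False by (simp add: walk_pos vert_edge)
  also have "fst (edge ?e) = Eps (vert (?e + 1)) \<longleftrightarrow> cut (?e + 1)" using edge_Eps by metis
  also have "fst (edge p) = Eps (vert p) \<longleftrightarrow> cut (p + 1)" using edge_Eps by metis
  also have "\<not> (cut x \<and> cut (x + 1))" for x
    using dvd_diff[of "int n + 1" "x + 1" x] n2 unfolding cut_def by auto
  then have "((vert (?e + 1) \<in> {0, n} \<longrightarrow> cut (?e + 1)) \<and> (vert p \<in> {0, n} \<longrightarrow> cut (p + 1)))
     \<longleftrightarrow> \<not> cut p \<and> \<not> cut (?e + 1 + 1)"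
    unfolding vert_0_or_n by blast
  finally show ?thesis unfolding e .
qed

lemma St_lf_iff:
  "w \<in> St_lf n \<Omega> \<longleftrightarrow> is_string n \<Omega> w \<and>
     (\<exists>p l. similar w (walk p l) \<and> \<not> cut p \<and> \<not> cut (p + int l + 1))"
  unfolding St_lf_def using similar_walk_exists similar_loc_free loc_free_walk by blast

section \<open>Ranks of walks\<close>

text \<open>The positions \<open>period \<cdot> m + a\<close> with sign \<open>-1\<close> and \<open>period \<cdot> m - a\<close> with sign \<open>1\<close>, for \<open>1 \<le> a \<le> n\<close>, are
  all positions that are no cuts. The sign is the one of \<open>e\<^sub>a\<close> in the rank of a walk that ends there.\<close>

definition coord_index :: "int \<Rightarrow> nat" where
  "coord_index x = nat (if x mod period \<le> int n then x mod period else period - x mod period)"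

definition coord_sign :: "int \<Rightarrow> int" where
  "coord_sign x = (if x mod period \<le> int n then -1 else 1)"

lemma coordinate_cases:
  assumes "\<not> cut x"
  obtains (up) m k where "k \<in> {1..n}" "x = period * m + int k" "x div period = m" "coord_index x = k" "coord_sign x = -1"
    | (down) m k where "k \<in> {1..n}" "x = period * m - int k" "x div period = m - 1" "coord_index x = k" "coord_sign x = 1"
proof -
  have r: "0 \<le> x mod period" "x mod period < period" by (rule mod_period_bounds)+
  have x: "x = period * (x div period) + x mod period" by simp
  have "x mod period \<noteq> 0" using assms by (auto simp: cut_iff)
  note N = half_period_dvd
  have "x mod period \<noteq> int n + 1"
  proof
    assume "x mod period = int n + 1"
    then have "x = period * (x div period) + (int n + 1)" using x by simp
    then show False using assms N unfolding cut_def by (metis dvd_add dvd_refl)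
  qed
  show thesis
  proof (cases "x mod period \<le> int n")
    case True
    then show thesis
      using up[of "nat (x mod period)" "x div period"] r x \<open>x mod period \<noteq> 0\<close>
      by (simp add: coord_index_def coord_sign_def)
  next
    case False
    have "0 < period - x mod period" using r by simp
    moreover have "period - r \<le> int n" if "\<not> r \<le> int n" "r \<noteq> int n + 1" for r
      using that period_def by auto
    then have "period - x mod period \<le> int n" using False \<open>x mod period \<noteq> int n + 1\<close> .
    moreover have "nat a \<in> {1..n}" if "0 < a" "a \<le> int n" for a using that by auto
    ultimately have "nat (period - x mod period) \<in> {1..n}" by blast
    moreover have "x = period * (x div period + 1) - int (nat (period - x mod period))"
      using r x by (simp add: algebra_simps)
    ultimately show thesis
      using down[of "nat (period - x mod period)" "x div period + 1"] False
      by (simp add: coord_index_def coord_sign_def)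
  qed
qed

lemma coord_index_range: "\<not> cut x \<Longrightarrow> coord_index x \<in> {1..n}"
  by (cases x rule: coordinate_cases) simp_all

lemma coord_sign_range: "coord_sign x \<in> {1, -1}"
  by (simp add: coord_sign_def)

lemma coordinates_up:
  assumes "k \<in> {1..n}"
  shows "\<not> cut (period * m + int k)" "(period * m + int k) div period = m"
    "coord_index (period * m + int k) = k" "coord_sign (period * m + int k) = -1"
proof -
  have "(period * m + int k) mod period = int k"
    using assms period_pos by (intro mod_period_eqI[of _ m]) auto
  moreover show "(period * m + int k) div period = m"
    using assms period_pos by (intro int_div_pos_eq[of _ _ _ "int k"]) auto
  ultimately show "coord_index (period * m + int k) = k" "coord_sign (period * m + int k) = -1"
    using assms by (simp_all add: coord_index_def coord_sign_def)
  have "\<not> int n + 1 dvd int k" using assms by (auto dest: zdvd_imp_le)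
  moreover note half_period_dvd[of m]
  ultimately show "\<not> cut (period * m + int k)" unfolding cut_def by (simp add: dvd_add_right_iff)
qed

lemma coordinates_down:
  assumes "k \<in> {1..n}"
  shows "\<not> cut (period * m - int k)" "(period * m - int k) div period = m - 1"
    "coord_index (period * m - int k) = k" "coord_sign (period * m - int k) = 1"
proof -
  have *: "period * m - int k = period * (m - 1) + (period - int k)" by (simp add: algebra_simps)
  then have "(period * m - int k) mod period = period - int k"
    using assms period_pos by (intro mod_period_eqI[of _ "m - 1"]) auto
  moreover show "(period * m - int k) div period = m - 1"
    using assms period_pos * by (intro int_div_pos_eq[of _ _ _ "period - int k"]) auto
  ultimately show "coord_index (period * m - int k) = k" "coord_sign (period * m - int k) = 1"
    using assms period_pos by (simp_all add: coord_index_def coord_sign_def)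
  have "\<not> int n + 1 dvd - int k" using assms by (auto dest: zdvd_imp_le)
  moreover note half_period_dvd[of m]
  ultimately have "\<not> int n + 1 dvd period * m + - int k" by (simp only: dvd_add_right_iff simp_thms)
  then show "\<not> cut (period * m - int k)" unfolding cut_def by simp
qed

lemma exists_coordinates:
  assumes "k \<in> {1..n}" "s \<in> {1, -1}"
  obtains x where "\<not> cut x" "x div period = m" "coord_index x = k" "coord_sign x = s"
proof (cases "s = 1")
  case True
  then show thesis using that[of "period * (m + 1) - int k"] coordinates_down[OF assms(1), of "m + 1"] by simp
next
  case False
  then show thesis using that[of "period * m + int k"] coordinates_up[OF assms(1), of m] assms(2) by simp
qed

lemma coordinates_minus:
  assumes "\<not> cut x"
  shows "coord_index (- x) = coord_index x" "coord_sign (- x) = - coord_sign x" "(- x) div period = - (x div period) - 1"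
proof -
  have "coord_index (- x) = coord_index x \<and> coord_sign (- x) = - coord_sign x \<and> (- x) div period = - (x div period) - 1"
    using assms
  proof (cases x rule: coordinate_cases)
    case (up m k)
    have "- x = period * (- m) - int k" using up by simp
    note c = coordinates_down(2-4)[OF up(1), of "- m", folded this]
    show ?thesis unfolding c using up by simp
  next
    case (down m k)
    have "- x = period * (- m) + int k" using down by simp
    note c = coordinates_up(2-4)[OF down(1), of "- m", folded this]
    show ?thesis unfolding c using down by simp
  qed
  then show "coord_index (- x) = coord_index x" "coord_sign (- x) = - coord_sign x" "(- x) div period = - (x div period) - 1" by auto
qed

lemma coordinates_recover:
  assumes "\<not> cut x"
  shows "x = period * (x div period) + (if coord_sign x = -1 then int (coord_index x) else period - int (coord_index x))"
  using assms
proof (cases x rule: coordinate_cases)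
  case (down m k)
  then have "m = x div period + 1" by simp
  then have "period * m = period * (x div period) + period" by (simp only: distrib_left mult_1_right)
  then show ?thesis using down by simp
qed simp

lemma coordinates_eq:
  assumes "\<not> cut x" "\<not> cut y" "coord_index x = coord_index y" "coord_sign x = coord_sign y"
  shows "x - y = period * (x div period - y div period)"
  using coordinates_recover[OF assms(1)] coordinates_recover[OF assms(2)] assms(3,4)
  unfolding right_diff_distrib by (auto split: if_splits)

lemma coordinates_cong_iff:
  assumes "\<not> cut x" "\<not> cut y"
  shows "coord_index x = coord_index y \<and> coord_sign x = coord_sign y \<longleftrightarrow> period dvd x - y"
proof
  assume "period dvd x - y"
  then have "x mod period = y mod period" by (simp add: mod_eq_dvd_iff)
  then show "coord_index x = coord_index y \<and> coord_sign x = coord_sign y" by (simp add: coord_index_def coord_sign_def)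
qed (use coordinates_eq[OF assms] in auto)

text \<open>Counts the positions over \<open>i\<close> to the left of \<open>x\<close>, up to a constant: one summand for each of the two
  residues \<open>i\<close> and \<open>- 1 - i\<close>.\<close>

definition vertex_count :: "nat \<Rightarrow> int \<Rightarrow> int" where
  "vertex_count i x = (x + int i) div period + (x - int i - 1) div period"

lemma vertex_count_step:
  assumes "i \<le> n"
  shows "vertex_count i (x + 1) = vertex_count i x + (if vert x = i then 1 else 0)"
proof -
  \<comment> \<open>The two residues have different parity and the period is even.\<close>
  have "\<not> (period dvd x - int i \<and> period dvd x + int i + 1)"
  proof
    assume "period dvd x - int i \<and> period dvd x + int i + 1"
    then have "even (x - int i)" "even (x + int i + 1)" using even_period dvd_trans by blast+
    then show False by presburger
  qed
  then show ?thesis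
    using div_period_step[of "x + int i"] div_period_step[of "x - int i - 1"]
    by (auto simp: vertex_count_def vert_eq_iff[OF assms] add.commute add.left_commute)
qed

lemma count_vertices:
  "i \<le> n \<Longrightarrow> int (count_list (map (\<lambda>j. vert (p + int j)) [0..<l]) i) = vertex_count i (p + int l) - vertex_count i p"
proof (induction l)
  case (Suc l)
  then show ?case using vertex_count_step[of i "p + int l"] by (simp add: add.commute add.left_commute)
qed simp

lemma vertex_count_coordinates:
  assumes "\<not> cut x" "i \<le> n"
  shows "vertex_count i x = 2 * (x div period) + (if coord_index x \<le> i then coord_sign x else 0)"
  using assms(1)
proof (cases x rule: coordinate_cases)
  case (up m k)
  have "(x + int i) div period = m"
    using up assms(2) period_pos by (intro div_period_eqI[of _ _ "int k + int i"]) auto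
  moreover have "(x - int i - 1) div period = m - 1" if "k \<le> i"
    using up assms(2) period_pos that
    by (intro div_period_eqI[of _ _ "int k - int i - 1 + period"]) (auto simp: right_diff_distrib)
  moreover have "(x - int i - 1) div period = m" if "\<not> k \<le> i"
    using up assms(2) period_pos that by (intro div_period_eqI[of _ _ "int k - int i - 1"]) auto
  ultimately show ?thesis unfolding vertex_count_def up(3-5) by simp
next
  case (down m k)
  have "(x - int i - 1) div period = m - 1"
    using down assms(2) period_pos
    by (intro div_period_eqI[of _ _ "period - int k - int i - 1"]) (auto simp: right_diff_distrib)
  moreover have "(x + int i) div period = m" if "k \<le> i"
    using down assms(2) period_pos that by (intro div_period_eqI[of _ _ "int i - int k"]) auto
  moreover have "(x + int i) div period = m - 1" if "\<not> k \<le> i"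
    using down assms(2) period_pos that
    by (intro div_period_eqI[of _ _ "int i - int k + period"]) (auto simp: right_diff_distrib)
  ultimately show ?thesis unfolding vertex_count_def down(3-5) by simp
qed

text \<open>The vector \<open>k \<rho> + s\<^sub>e e\<^sub>a - s\<^sub>p e\<^sub>b\<close>, where \<open>a\<close>, \<open>s\<^sub>e\<close> are the coordinates of \<open>e\<close> and \<open>b\<close>, \<open>s\<^sub>p\<close> those of
  \<open>p\<close>. It is defined for \<open>e \<le> p\<close> as well, where it is the negative of a rank or zero.\<close>

definition rank :: "int \<Rightarrow> int \<Rightarrow> nat \<Rightarrow> int" where
  "rank p e = root_vec n (e div period - p div period) (coord_index e) (coord_sign e) (coord_index p) (- coord_sign p)"

lemma rk_walk:
  assumes "\<not> cut p" "\<not> cut (p + int l + 1)"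
  shows "rk n \<Omega> (walk p l) = rank p (p + int l + 1)"
proof
  fix i
  let ?e = "p + int l + 1"
  have e: "?e = p + int (Suc l)" by simp
  show "rk n \<Omega> (walk p l) i = rank p ?e i"
  proof (cases "i \<le> n")
    case True
    have "int (count_list (vertex_seq \<Omega> (walk p l)) i) = vertex_count i ?e - vertex_count i p"
      unfolding vertex_seq_walk count_vertices[OF True] e ..
    also have "\<dots> = 2 * (?e div period - p div period)
        + (if coord_index ?e \<le> i then coord_sign ?e else 0) + (if coord_index p \<le> i then - coord_sign p else 0)"
      using vertex_count_coordinates[OF assms(1) True] vertex_count_coordinates[OF assms(2) True] by simp
    finally show ?thesis
      using coord_index_range[OF assms(1)] coord_index_range[OF assms(2)] coord_sign_range[of p] coord_sign_range[of ?e] True n2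
      unfolding rk_def rank_def root_vec_def by (auto simp: Let_def)
  next
    case False
    then have "i \<notin> set (vertex_seq \<Omega> (walk p l))"
      unfolding vertex_seq_walk using vert_le by (auto simp: not_le[symmetric])
    then show ?thesis using False n2 by (auto simp: rk_def rank_def root_vec_def)
  qed
qed

lemma rank_root_index_iff:
  assumes "\<not> cut p" "\<not> cut e"
  shows "root_index n (coord_index e) (coord_sign e) (coord_index p) (- coord_sign p) \<longleftrightarrow> \<not> period dvd e - p"
  using coord_index_range[OF assms(1)] coord_index_range[OF assms(2)] coord_sign_range[of p] coord_sign_range[of e]
    coordinates_cong_iff[OF assms(2,1)]
  by (auto simp: root_index_def)

lemma rank_imaginary:
  assumes "\<not> cut p" "\<not> cut e" "e - p = period * k"
  shows "rank p e = (\<lambda>j. k * rho n j)"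
proof -
  have c: "coord_index e = coord_index p" "coord_sign e = coord_sign p" using coordinates_cong_iff[OF assms(2,1)] assms(3) by auto
  have "e div period - p div period = k"
    using coordinates_eq[OF assms(2,1) c] assms(3) period_pos by simp
  then show ?thesis
    using c coord_index_range[OF assms(1)] by (auto simp: rank_def root_vec_def rho_def fun_eq_iff)
qed

lemma rank_real:
  assumes "\<not> cut p" "\<not> cut e" "\<not> period dvd e - p"
  shows "rank p e \<in> real_roots n"
  unfolding rank_def by (intro root_vec_in_real_roots n2) (simp add: rank_root_index_iff assms)

lemma rank_imaginary_iff:
  assumes "\<not> cut p" "\<not> cut e"
  shows "rank p e = (\<lambda>j. k * rho n j) \<longleftrightarrow> e - p = period * k"
proof
  assume eq: "rank p e = (\<lambda>j. k * rho n j)"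
  have "period dvd e - p"
  proof (rule ccontr)
    assume "\<not> period dvd e - p"
    from rank_real[OF assms this] show False unfolding eq using imaginary_not_real[OF n2] by blast
  qed
  then obtain k' where k': "e - p = period * k'" by blast
  have "(\<lambda>j. k' * rho n j) = (\<lambda>j. k * rho n j)" using rank_imaginary[OF assms k'] eq by simp
  from fun_cong[OF this, of 0] have "k' = k" by (simp add: rho_def)
  then show "e - p = period * k" using k' by simp
qed (rule rank_imaginary[OF assms])

lemma rank_uminus: "rank e p i = - rank p e i"
  using coord_sign_range[of p] coord_sign_range[of e] by (auto simp: rank_def root_vec_def)

lemma rank_nonneg:
  assumes "\<not> cut p" "\<not> cut e" "p < e"
  shows "0 \<le> rank p e i"
proof -
  have e: "e = p + int (nat (e - p - 1)) + 1" using assms by simp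
  have "0 \<le> rk n \<Omega> (walk p (nat (e - p - 1))) i" by (simp add: rk_def Let_def)
  then show ?thesis using rk_walk[OF assms(1), of "nat (e - p - 1)"] e assms(2) by simp
qed

lemma St_lf_rank_iff:
  "v \<in> St_lf n \<Omega> \<and> rk n \<Omega> v = \<beta> \<longleftrightarrow> is_string n \<Omega> v \<and>
     (\<exists>p l. similar v (walk p l) \<and> \<not> cut p \<and> \<not> cut (p + int l + 1) \<and> rank p (p + int l + 1) = \<beta>)"
proof -
  have "rank p (p + int l + 1) = \<beta> \<longleftrightarrow> rk n \<Omega> v = \<beta>"
    if "is_string n \<Omega> v" "similar v (walk p l)" "\<not> cut p" "\<not> cut (p + int l + 1)" for p l
    using similar_rk[OF that(2,1)] rk_walk[OF that(3,4)] by simp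
  then show ?thesis unfolding St_lf_iff by blast
qed

text \<open>Every root is \<open>rank p e\<close> for suitable \<open>p\<close> and \<open>e\<close>; positivity forces \<open>p < e\<close>, because interchanging
  \<open>p\<close> and \<open>e\<close> changes the sign of the vector.\<close>

lemma rank_image: "rk n \<Omega> ` St_lf n \<Omega> = pos_roots n"
proof
  show "rk n \<Omega> ` St_lf n \<Omega> \<subseteq> pos_roots n"
  proof
    fix \<beta> assume "\<beta> \<in> rk n \<Omega> ` St_lf n \<Omega>"
    then obtain v where "v \<in> St_lf n \<Omega> \<and> rk n \<Omega> v = \<beta>" by blast
    then obtain p l where c: "\<not> cut p" "\<not> cut (p + int l + 1)" and \<beta>: "\<beta> = rank p (p + int l + 1)"
      unfolding St_lf_rank_iff by blast
    let ?e = "p + int l + 1"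
    show "\<beta> \<in> pos_roots n"
    proof (cases "period dvd ?e - p")
      case True
      then obtain k where k: "?e - p = period * k" by blast
      then have "0 < period * k" by simp
      then have "k \<ge> 1" using period_pos by (simp add: zero_less_mult_iff)
      then show ?thesis
        using rank_imaginary[OF c k] \<beta> by (auto simp: pos_roots_def pos_imag_roots_def)
    next
      case False
      then show ?thesis
        using rank_real[OF c False] rank_nonneg[OF c] \<beta> by (simp add: pos_roots_def pos_real_roots_def)
    qed
  qed
  have realize: "rank p e \<in> rk n \<Omega> ` St_lf n \<Omega>" if c: "\<not> cut p" "\<not> cut e" and "p < e" for p e
  proof -
    define l where "l = nat (e - p - 1)"
    have e: "e = p + int l + 1" using \<open>p < e\<close> by (simp add: l_def)
    have "walk p l \<in> St_lf n \<Omega>"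
      using c is_string_walk[of p l] loc_free_walk[of p l] by (simp add: St_lf_def e)
    moreover have "rk n \<Omega> (walk p l) = rank p e" using rk_walk[of p l] c by (simp add: e)
    ultimately show ?thesis by (metis imageI)
  qed
  show "pos_roots n \<subseteq> rk n \<Omega> ` St_lf n \<Omega>"
  proof
    fix \<beta> assume "\<beta> \<in> pos_roots n"
    then consider "\<beta> \<in> pos_real_roots n" | "\<beta> \<in> pos_imag_roots n" by (auto simp: pos_roots_def)
    then show "\<beta> \<in> rk n \<Omega> ` St_lf n \<Omega>"
    proof cases
      case 1
      then have "\<beta> \<in> real_roots n" and nonneg: "\<And>j. 0 \<le> \<beta> j" by (auto simp: pos_real_roots_def)
      then obtain k a \<sigma> b \<tau> where r: "root_index n a \<sigma> b \<tau>" and \<beta>: "\<beta> = root_vec n k a \<sigma> b \<tau>"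
        using real_roots_root_vec[OF n2] by blast
      have i: "a \<in> {1..n}" "b \<in> {1..n}" "\<sigma> \<in> {1, -1}" "- \<tau> \<in> {1, -1}"
        using r by (auto simp: root_index_def)
      \<comment> \<open>Only the difference of the quotients matters, so \<open>p\<close> is taken in the period that starts at \<open>0\<close>.\<close>
      obtain e where e: "\<not> cut e" "e div period = k" "coord_index e = a" "coord_sign e = \<sigma>"
        using exists_coordinates[OF i(1,3)] by metis
      obtain p where p: "\<not> cut p" "p div period = 0" "coord_index p = b" "coord_sign p = - \<tau>"
        using exists_coordinates[OF i(2,4)] by metis
      have rank: "\<beta> = rank p e" by (simp add: rank_def e p \<beta>)
      have "\<not> e \<le> p"
      proof
        assume "e \<le> p"
        have "\<beta> j = 0" for j
        proof (cases "e = p")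
          case True
          then show ?thesis using rank_uminus[of e p j] rank by simp
        next
          case False
          then have "0 \<le> rank e p j" using rank_nonneg[OF e(1) p(1)] \<open>e \<le> p\<close> by simp
          then show ?thesis using rank_uminus[of e p j] rank nonneg[of j] by simp
        qed
        then have "root_vec n k a \<sigma> b \<tau> = (\<lambda>j. 0 * rho n j)" using \<beta> by (simp add: fun_eq_iff)
        then show False using root_vec_not_imaginary[OF n2 r] by blast
      qed
      then show ?thesis using realize[OF p(1) e(1)] rank by simp
    next
      case 2
      then obtain k where k: "k \<ge> 1" "\<beta> = (\<lambda>j. k * rho n j)" by (auto simp: pos_imag_roots_def)
      have c1: "\<not> cut 1" using coordinates_up(1)[of 1 0] n2 by simp
      have "\<not> cut (1 + period * k)" using cut_period[of "1 + period * k" 1] c1 by simp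
      moreover have "1 < 1 + period * k" using k(1) period_pos by simp
      ultimately have "rank 1 (1 + period * k) \<in> rk n \<Omega> ` St_lf n \<Omega>" by (rule realize[OF c1])
      moreover have "rank 1 (1 + period * k) = \<beta>"
        unfolding k(2) using \<open>\<not> cut (1 + period * k)\<close> by (intro rank_imaginary[OF c1]) simp_all
      ultimately show ?thesis by simp
    qed
  qed
qed

section \<open>Fibres over real roots\<close>

text \<open>The root determines the unordered pair of signed coordinate vectors that belong to \<open>e\<close> and to
  \<open>- p\<close>. Either order of the pair gives one solution \<open>(p', e')\<close> up to the period: \<open>(p, e)\<close>, and \<open>(- e, - p)\<close>, since
  negating a position negates its vector.\<close>

lemma rank_eq_iff:
  assumes "\<not> cut p" "\<not> cut e" "\<not> cut p'" "\<not> cut e'" "\<not> period dvd e - p"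
  shows "rank p' e' = rank p e \<longleftrightarrow> e' - p' = e - p \<and> (period dvd p' - p \<or> period dvd p' + e)"
proof -
  have m: "\<not> cut (- p)" "\<not> cut (- e)" using assms by (simp_all add: cut_minus)
  show ?thesis
  proof
    assume "rank p' e' = rank p e"
    then have eq: "root_vec n (e div period - p div period) (coord_index e) (coord_sign e) (coord_index p) (- coord_sign p)
      = root_vec n (e' div period - p' div period) (coord_index e') (coord_sign e') (coord_index p') (- coord_sign p')"
      by (simp add: rank_def)
    have coord_sign': "- coord_sign p' \<in> {1, -1}" using coord_sign_range[of p'] by auto
    have "root_index n (coord_index e) (coord_sign e) (coord_index p) (- coord_sign p)" using assms by (simp add: rank_root_index_iff)
    from root_vec_inject[OF n2 this coord_index_range[OF assms(4)] coord_index_range[OF assms(3)] coord_sign_range coord_sign' eq]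
    have k: "e div period - p div period = e' div period - p' div period"
      and c: "coord_index e' = coord_index e \<and> coord_sign e' = coord_sign e \<and> coord_index p' = coord_index p \<and> coord_sign p' = coord_sign p
         \<or> coord_index e' = coord_index (- p) \<and> coord_sign e' = coord_sign (- p) \<and> coord_index p' = coord_index (- e) \<and> coord_sign p' = coord_sign (- e)"
      using coordinates_minus[OF assms(1)] coordinates_minus[OF assms(2)] by auto
    from c show "e' - p' = e - p \<and> (period dvd p' - p \<or> period dvd p' + e)"
    proof
      assume "coord_index e' = coord_index e \<and> coord_sign e' = coord_sign e \<and> coord_index p' = coord_index p \<and> coord_sign p' = coord_sign p"
      then have "e' - e = period * (e' div period - e div period)" "p' - p = period * (p' div period - p div period)"
        by (simp_all only: coordinates_eq[OF assms(4,2)] coordinates_eq[OF assms(3,1)])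
      moreover have "e' div period - e div period = p' div period - p div period" using k by simp
      ultimately have "e' - e = p' - p" "period dvd p' - p" by simp_all
      then show ?thesis by simp
    next
      assume "coord_index e' = coord_index (- p) \<and> coord_sign e' = coord_sign (- p) \<and> coord_index p' = coord_index (- e) \<and> coord_sign p' = coord_sign (- e)"
      then have "e' - (- p) = period * (e' div period - (- p) div period)"
        "p' - (- e) = period * (p' div period - (- e) div period)"
        by (simp_all only: coordinates_eq[OF assms(4) m(1)] coordinates_eq[OF assms(3) m(2)])
      moreover have "e' div period - (- p) div period = p' div period - (- e) div period"
        using k coordinates_minus(3)[OF assms(1)] coordinates_minus(3)[OF assms(2)] by simp
      ultimately have "e' + p = p' + e" "period dvd p' + e" by simp_all
      then show ?thesis by simp
    qed
  next
    assume R: "e' - p' = e - p \<and> (period dvd p' - p \<or> period dvd p' + e)"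
    from R have "period dvd p' - p \<or> period dvd p' + e" by simp
    then show "rank p' e' = rank p e"
    proof
      assume "period dvd p' - p"
      moreover have "e' - e = p' - p" using R by simp
      ultimately have c: "coord_index p' = coord_index p" "coord_sign p' = coord_sign p" "coord_index e' = coord_index e" "coord_sign e' = coord_sign e"
        using coordinates_cong_iff[OF assms(3,1)] coordinates_cong_iff[OF assms(4,2)] by simp_all
      have "period * (p' div period - p div period) = period * (e' div period - e div period)"
        by (simp only: coordinates_eq[OF assms(3,1) c(1,2), symmetric]
          coordinates_eq[OF assms(4,2) c(3,4), symmetric]) (use R in simp)
      then have "e' div period - p' div period = e div period - p div period" using period_pos by simp
      then show ?thesis using c by (simp add: rank_def)
    next
      assume "period dvd p' + e"
      moreover have "e' + p = p' + e" using R by simp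
      ultimately have c: "coord_index p' = coord_index (- e)" "coord_sign p' = coord_sign (- e)" "coord_index e' = coord_index (- p)" "coord_sign e' = coord_sign (- p)"
        using coordinates_cong_iff[OF assms(3) m(2)] coordinates_cong_iff[OF assms(4) m(1)] by auto
      have "period * (p' div period - (- e) div period) = period * (e' div period - (- p) div period)"
        by (simp only: coordinates_eq[OF assms(3) m(2) c(1,2), symmetric]
          coordinates_eq[OF assms(4) m(1) c(3,4), symmetric]) (use R in simp)
      then have "e' div period - p' div period = (- p) div period - (- e) div period"
        using period_pos by simp
      then have "e' div period - p' div period = e div period - p div period"
        using coordinates_minus(3)[OF assms(1)] coordinates_minus(3)[OF assms(2)] by simp
      then show ?thesis
        using c coordinates_minus[OF assms(1)] coordinates_minus[OF assms(2)]
          root_vec_commute[of n _ "coord_index p" "- coord_sign p"] by (simp add: rank_def)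
    qed
  qed
qed

text \<open>Long roots are those with \<open>a = b\<close>, that is, \<open>e\<close> and \<open>- p\<close> have the same coordinates; then the
  walk agrees with its reflection.\<close>

lemma long_rank_iff:
  assumes "\<not> cut p" "\<not> cut e" "\<not> period dvd e - p"
  shows "long_root n (rank p e) \<longleftrightarrow> period dvd e + p"
proof -
  have r: "root_index n (coord_index e) (coord_sign e) (coord_index p) (- coord_sign p)" using assms by (simp add: rank_root_index_iff)
  have "long_root n (rank p e) \<longleftrightarrow> coord_index e = coord_index p"
    using rank_real[OF assms] root_vec_norm[OF n2 r] unfolding long_root_def rank_def by simp
  also have "\<dots> \<longleftrightarrow> coord_index e = coord_index (- p) \<and> coord_sign e = coord_sign (- p)"
    using r coordinates_minus[OF assms(1)] by (auto simp: root_index_def)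
  also have "\<dots> \<longleftrightarrow> period dvd e + p"
    using coordinates_cong_iff[of e "- p"] assms by (simp add: cut_minus)
  finally show ?thesis .
qed

lemma real_fibre:
  assumes w: "w \<in> St_lf n \<Omega>" and real: "rk n \<Omega> w \<in> pos_real_roots n"
  shows "{v \<in> St_lf n \<Omega>. rk n \<Omega> v = rk n \<Omega> w} = sim_class n \<Omega> w \<union> sim_class n \<Omega> (str_inv w)"
    "sim_class n \<Omega> w = sim_class n \<Omega> (str_inv w) \<longleftrightarrow> long_root n (rk n \<Omega> w)"
proof -
  obtain p l where s: "similar w (walk p l)" and c: "\<not> cut p" "\<not> cut (p + int l + 1)"
    and rank: "rk n \<Omega> w = rank p (p + int l + 1)"
    using w St_lf_rank_iff[of w "rk n \<Omega> w"] by auto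
  define e where "e = p + int l + 1"
  note c' = c[folded e_def] and rank' = rank[folded e_def]
  have nd: "\<not> period dvd e - p"
  proof
    assume "period dvd e - p"
    then obtain k where "e - p = period * k" by blast
    from rank_imaginary[OF c' this] show False
      using real rank' imaginary_not_real[OF n2] by (simp add: pos_real_roots_def)
  qed
  have W: "sim_class n \<Omega> w = sim_class n \<Omega> (walk p l)"
    by (rule sim_class_similar[OF s])
  have V: "sim_class n \<Omega> (str_inv w) = sim_class n \<Omega> (walk (- e) l)"
    unfolding e_def by (rule sim_class_similar[OF similar_trans[OF similar_str_inv[OF s] str_inv_walk]])
  show "{v \<in> St_lf n \<Omega>. rk n \<Omega> v = rk n \<Omega> w} = sim_class n \<Omega> w \<union> sim_class n \<Omega> (str_inv w)"
  proof (intro set_eqI)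
    fix v
    have "v \<in> {v \<in> St_lf n \<Omega>. rk n \<Omega> v = rk n \<Omega> w} \<longleftrightarrow> is_string n \<Omega> v \<and>
       (\<exists>p' l'. similar v (walk p' l') \<and> \<not> cut p' \<and> \<not> cut (p' + int l' + 1) \<and>
          rank p' (p' + int l' + 1) = rank p e)"
      using St_lf_rank_iff[of v "rank p e"] rank' by simp
    also have "\<dots> \<longleftrightarrow> is_string n \<Omega> v \<and> (\<exists>p'. similar v (walk p' l) \<and> \<not> cut p' \<and> \<not> cut (p' + int l + 1) \<and>
         (period dvd p' - p \<or> period dvd p' + e))"
    proof -
      have "rank p' (p' + int l' + 1) = rank p e \<longleftrightarrow> l' = l \<and> (period dvd p' - p \<or> period dvd p' + e)"
        if "\<not> cut p'" "\<not> cut (p' + int l' + 1)" for p' l'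
        using rank_eq_iff[OF c' that nd] by (auto simp: e_def)
      then show ?thesis by blast
    qed
    also have "\<dots> \<longleftrightarrow> is_string n \<Omega> v \<and> (similar v (walk p l) \<or> similar v (walk (- e) l))"
    proof -
      have "walk p' l = walk p l \<or> walk p' l = walk (- e) l" if "period dvd p' - p \<or> period dvd p' + e" for p'
        using that walk_period[of p' p] walk_period[of p' "- e"] by auto
      moreover have "\<not> cut p \<and> \<not> cut (p + int l + 1) \<and> (period dvd p - p \<or> period dvd p + e)"
        using c by simp
      moreover have "- e + int l + 1 = - p" by (simp add: e_def)
      then have "\<not> cut (- e) \<and> \<not> cut (- e + int l + 1) \<and> (period dvd - e - p \<or> period dvd - e + e)"
        using c' by (simp add: cut_minus)
      ultimately show ?thesis by metis
    qed
    finally show "v \<in> {v \<in> St_lf n \<Omega>. rk n \<Omega> v = rk n \<Omega> w} \<longleftrightarrow> v \<in> sim_class n \<Omega> w \<union> sim_class n \<Omega> (str_inv w)"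
      unfolding W V Un_iff in_sim_class_walk by blast
  qed
  show "sim_class n \<Omega> w = sim_class n \<Omega> (str_inv w) \<longleftrightarrow> long_root n (rk n \<Omega> w)"
    unfolding W V rank' sim_class_walk_eq_iff long_rank_iff[OF c' nd] by (simp add: add.commute)
qed

section \<open>Fibres over imaginary roots\<close>

text \<open>The position \<open>c\<^sub>i\<close> at which the direct letter \<open>\<eta>\<^sub>i\<close> ends, chosen in \<open>{- n..n}\<close>.\<close>

definition eta_head :: "nat \<Rightarrow> int" where
  "eta_head i = (if (i - 1, i) \<in> \<Omega> then int i else - int i)"

lemma edge_eta_head: "i \<in> {1..n} \<Longrightarrow> edge (eta_head i - 1) = (Eta i, Pos)"
  using edge_up[of i 0] edge_down[of i 0] by (simp add: eta_head_def)

lemma edge_Pos_iff: "edge (x - 1) = (Eta i, Pos) \<longleftrightarrow> i \<in> {1..n} \<and> period dvd x - eta_head i"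
proof
  assume e: "edge (x - 1) = (Eta i, Pos)"
  show "i \<in> {1..n} \<and> period dvd x - eta_head i"
  proof (cases "x - 1" rule: edge_position_cases)
    case (up m k)
    then have "i = k" "(k - 1, k) \<in> \<Omega>" using e edge_up[OF up(1), of m] by (auto split: if_splits)
    then show ?thesis using up by (simp add: eta_head_def)
  next
    case (down m k)
    then have "i = k" "(k - 1, k) \<notin> \<Omega>" using e edge_down[OF down(1), of m] by (auto split: if_splits)
    then show ?thesis using down by (simp add: eta_head_def)
  next
    case (top m)
    then show ?thesis using e edge_top[of m] by simp
  next
    case (bottom m)
    then show ?thesis using e edge_bottom[of m] by simp
  qed
next
  assume "i \<in> {1..n} \<and> period dvd x - eta_head i"
  then show "edge (x - 1) = (Eta i, Pos)"
    using edge_eta_head[of i] edge_period[of "x - 1" "eta_head i - 1"] by simp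
qed

lemma edge_Eps_Neg:
  assumes "fst (edge x) = Eps i"
  shows "snd (edge x) = Neg"
proof (cases x rule: edge_position_cases)
  case (up m k)
  then show ?thesis using assms edge_up[OF up(1), of m] by simp
next
  case (top m)
  then show ?thesis using edge_top[of m] by simp
next
  case (down m k)
  then show ?thesis using assms edge_down[OF down(1), of m] by simp
next
  case (bottom m)
  then show ?thesis using edge_bottom[of m] by simp
qed

lemma snd_edge_Pos: "snd (edge (x - 1)) = Pos \<longleftrightarrow> (\<exists>i\<in>{1..n}. period dvd x - eta_head i)"
proof
  assume "snd (edge (x - 1)) = Pos"
  then have "\<exists>i. edge (x - 1) = (Eta i, Pos)"
    using edge_Eps_Neg[of "x - 1"] by (cases "fst (edge (x - 1))") (auto simp: prod_eq_iff)
  then show "\<exists>i\<in>{1..n}. period dvd x - eta_head i" using edge_Pos_iff by blast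
next
  assume "\<exists>i\<in>{1..n}. period dvd x - eta_head i"
  then obtain i where "edge (x - 1) = (Eta i, Pos)" using edge_Pos_iff by blast
  then show "snd (edge (x - 1)) = Pos" by simp
qed

lemma eta_head_abs: "\<bar>eta_head i\<bar> = int i"
  by (simp add: eta_head_def)

text \<open>Together with \<open>eta_head_cover\<close>, this says that the \<open>\<plusminus> c\<^sub>i\<close> represent each residue class that
  contains no cut exactly once; it holds because \<open>c\<^sub>i\<close> is \<open>i\<close> or \<open>- i\<close>.\<close>

lemma eta_head_distinct:
  assumes "i \<in> {1..n}" "j \<in> {1..n}"
  shows "period dvd eta_head i - eta_head j \<Longrightarrow> i = j" "\<not> period dvd eta_head i + eta_head j"
proof -
  have b: "\<bar>eta_head i\<bar> \<le> int n" "\<bar>eta_head j\<bar> \<le> int n" using assms by (simp_all add: eta_head_abs)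
  show "i = j" if "period dvd eta_head i - eta_head j"
  proof -
    have "\<bar>eta_head i - eta_head j\<bar> < period" using b period_pos by linarith
    then have "eta_head i = eta_head j" using dvd_period_small[OF that] by simp
    then have "int i = int j" by (metis eta_head_abs)
    then show ?thesis by simp
  qed
  show "\<not> period dvd eta_head i + eta_head j"
  proof
    assume "period dvd eta_head i + eta_head j"
    moreover have "\<bar>eta_head i + eta_head j\<bar> < period" using b period_pos by linarith
    ultimately have "eta_head i + eta_head j = 0" by (rule dvd_period_small)
    then have neg: "eta_head j = - eta_head i" by linarith
    then have "int i = int j" by (metis eta_head_abs abs_minus_cancel)
    then have "eta_head i = - eta_head i" using neg by simp
    then show False using eta_head_abs[of i] assms(1) by simp
  qed
qed

lemma eta_head_cover:
  assumes "\<not> cut p"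
  obtains i where "i \<in> {1..n}" "period dvd p - eta_head i \<or> period dvd p + eta_head i"
  using assms
proof (cases p rule: coordinate_cases)
  case (up m k)
  then have "period dvd p - eta_head k \<or> period dvd p + eta_head k" by (auto simp: eta_head_def)
  then show thesis using that up(1) by blast
next
  case (down m k)
  then have "period dvd p - eta_head k \<or> period dvd p + eta_head k" by (auto simp: eta_head_def)
  then show thesis using that down(1) by blast
qed

lemma snd_edge_Pos_not_cut: "snd (edge x) = Pos \<Longrightarrow> \<not> cut (x + 1)"
  using edge_Eps(1)[of x] edge_Eps_Neg[of x] by auto

lemma eta_head_not_cut: "i \<in> {1..n} \<Longrightarrow> \<not> cut (eta_head i)"
  using snd_edge_Pos_not_cut[of "eta_head i - 1"] edge_eta_head[of i] by simp

text \<open>A walk has rank \<open>k \<rho>\<close> iff it covers \<open>k\<close> periods, with no condition on its start except that it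
  is no cut.\<close>

lemma imaginary_fibre:
  assumes k: "k \<ge> 1"
  shows "{v \<in> St_lf n \<Omega>. rk n \<Omega> v = (\<lambda>j. int k * rho n j)} =
    (\<Union>i\<in>{1..n}. sim_class n \<Omega> (walk (eta_head i) (nat (period * int k - 1))) \<union>
       sim_class n \<Omega> (walk (- eta_head i) (nat (period * int k - 1))))"
proof (intro set_eqI)
  fix v
  define l where "l = nat (period * int k - 1)"
  have pk: "period * int k \<ge> 1" using k period_pos by (simp add: int_one_le_iff_zero_less)
  then have l: "int l + 1 = period * int k" by (simp add: l_def)
  have "v \<in> {v \<in> St_lf n \<Omega>. rk n \<Omega> v = (\<lambda>j. int k * rho n j)} \<longleftrightarrow> is_string n \<Omega> v \<and>
     (\<exists>p l'. similar v (walk p l') \<and> \<not> cut p \<and> \<not> cut (p + int l' + 1) \<and> int l' + 1 = period * int k)"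
  proof -
    have "rank p (p + int l' + 1) = (\<lambda>j. int k * rho n j) \<longleftrightarrow> int l' + 1 = period * int k"
      if "\<not> cut p" "\<not> cut (p + int l' + 1)" for p l'
      using rank_imaginary_iff[OF that, of "int k"] by simp
    then show ?thesis using St_lf_rank_iff[of v "\<lambda>j. int k * rho n j"] by blast
  qed
  also have "\<dots> \<longleftrightarrow> is_string n \<Omega> v \<and> (\<exists>p. similar v (walk p l) \<and> \<not> cut p)"
  proof -
    have "cut (p + int l + 1) \<longleftrightarrow> cut p" for p
      using cut_period[of "p + int l + 1" p] l by simp
    moreover have "int l' + 1 = period * int k \<longleftrightarrow> l' = l" for l' using l by auto
    ultimately show ?thesis by auto
  qed
  also have "\<dots> \<longleftrightarrow> is_string n \<Omega> v \<and>
      (\<exists>i\<in>{1..n}. similar v (walk (eta_head i) l) \<or> similar v (walk (- eta_head i) l))"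
  proof -
    have "\<exists>i\<in>{1..n}. walk p l = walk (eta_head i) l \<or> walk p l = walk (- eta_head i) l" if "\<not> cut p" for p
      using eta_head_cover[OF that] walk_period[of p] by (metis diff_minus_eq_add)
    moreover have "\<not> cut (eta_head i)" "\<not> cut (- eta_head i)" if "i \<in> {1..n}" for i
      using eta_head_not_cut[OF that] by (simp_all add: cut_minus)
    ultimately show ?thesis by metis
  qed
  finally show "v \<in> {v \<in> St_lf n \<Omega>. rk n \<Omega> v = (\<lambda>j. int k * rho n j)} \<longleftrightarrow>
    v \<in> (\<Union>i\<in>{1..n}. sim_class n \<Omega> (walk (eta_head i) (nat (period * int k - 1))) \<union>
       sim_class n \<Omega> (walk (- eta_head i) (nat (period * int k - 1))))"
    unfolding l_def[symmetric] by (auto simp: in_sim_class_walk)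
qed

section \<open>The shifted strings\<close>

text \<open>The number of letters that can be read from \<open>x\<close> on before the next direct letter, which is the
  length of the longest inverse string that starts there.\<close>

definition gap :: "int \<Rightarrow> nat" where
  "gap x = (LEAST d. snd (edge (x + int d)) = Pos)"

definition next_head :: "int \<Rightarrow> int" where
  "next_head x = x + int (gap x) + 1"

lemma gap_Pos: "snd (edge (x + int (gap x))) = Pos"
proof -
  define d where "d = (eta_head 1 - 1 - x) mod period"
  have "0 \<le> d" unfolding d_def by (rule mod_period_bounds)
  then have "x + int (nat d) - (eta_head 1 - 1) = - (eta_head 1 - 1 - x - d)" by simp
  moreover have "period dvd eta_head 1 - 1 - x - d" unfolding d_def by (rule dvd_minus_mod)
  ultimately have "period dvd x + int (nat d) - (eta_head 1 - 1)" by (simp only: dvd_minus_iff)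
  then have "edge (x + int (nat d)) = edge (eta_head 1 - 1)" by (rule edge_period)
  also have "\<dots> = (Eta 1, Pos)" using n2 by (intro edge_eta_head) simp
  finally have "snd (edge (x + int (nat d))) = Pos" by simp
  then show ?thesis unfolding gap_def by (rule LeastI)
qed

lemma gap_Neg: "d < gap x \<Longrightarrow> snd (edge (x + int d)) = Neg"
  using not_less_Least[of d "\<lambda>d. snd (edge (x + int d)) = Pos"]
  by (cases "snd (edge (x + int d))") (simp_all add: gap_def)

lemma gap_period: "period dvd x - y \<Longrightarrow> gap x = gap y"
proof -
  assume "period dvd x - y"
  then have "edge (x + int d) = edge (y + int d)" for d by (intro edge_period) simp
  then show ?thesis by (simp add: gap_def)
qed

text \<open>Counts, up to a constant, the direct letters that end at or before \<open>x\<close>; it is used to recognise the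
  iterates of \<open>next_head\<close>.\<close>

definition head_count :: "int \<Rightarrow> int" where
  "head_count x = (\<Sum>i\<in>{1..n}. (x - eta_head i) div period)"

lemma head_count_step: "head_count (x + 1) = head_count x + (if snd (edge x) = Pos then 1 else 0)"
proof -
  have "head_count (x + 1) = (\<Sum>i\<in>{1..n}. (x - eta_head i) div period + (if period dvd x + 1 - eta_head i then 1 else 0))"
    unfolding head_count_def
  proof (intro sum.cong refl)
    fix i
    have *: "x - eta_head i + 1 = x + 1 - eta_head i" by simp
    show "(x + 1 - eta_head i) div period = (x - eta_head i) div period + (if period dvd x + 1 - eta_head i then 1 else 0)"
      using div_period_step[of "x - eta_head i"] unfolding * .
  qed
  also have "\<dots> = head_count x + int (card {i \<in> {1..n}. period dvd x + 1 - eta_head i})"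
    by (simp add: sum.distrib head_count_def sum.If_cases Int_def)
  also have "int (card {i \<in> {1..n}. period dvd x + 1 - eta_head i}) = (if snd (edge x) = Pos then 1 else 0)"
  proof (cases "snd (edge x) = Pos")
    case True
    then obtain i where i: "i \<in> {1..n}" "period dvd x + 1 - eta_head i" using snd_edge_Pos[of "x + 1"] by auto
    have "j = i" if j: "j \<in> {1..n}" "period dvd x + 1 - eta_head j" for j
      using eta_head_distinct(1)[OF i(1) j(1)] dvd_diff[OF j(2) i(2)] by simp
    then have "{i \<in> {1..n}. period dvd x + 1 - eta_head i} = {i}" using i by blast
    then show ?thesis using True by simp
  next
    case False
    then have "{i \<in> {1..n}. period dvd x + 1 - eta_head i} = {}" using snd_edge_Pos[of "x + 1"] by auto
    then show ?thesis using False by simp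
  qed
  finally show ?thesis .
qed

lemma head_count_next: "head_count (next_head x) = head_count x + 1"
proof -
  have "head_count (x + int d) = head_count x" if "d \<le> gap x" for d
    using that
  proof (induction d)
    case (Suc d)
    then show ?case using head_count_step[of "x + int d"] gap_Neg[of d x] by (simp add: algebra_simps)
  qed simp
  then show ?thesis
    using head_count_step[of "x + int (gap x)"] gap_Pos[of x] by (simp add: next_head_def)
qed

lemma head_count_period: "head_count (x + period * k) = head_count x + int n * k"
proof -
  have "(x + period * k - eta_head i) div period = (x - eta_head i) div period + k" for i
    using div_mult_self2[of period "x - eta_head i" k] period_pos by (simp add: algebra_simps)
  then show ?thesis by (simp add: head_count_def sum.distrib)
qed

lemma head_count_strict:
  assumes "x < y" "snd (edge (y - 1)) = Pos"
  shows "head_count x < head_count y"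
proof -
  have "head_count x \<le> head_count (y - 1)"
    unfolding head_count_def using assms(1) period_pos by (intro sum_mono zdiv_mono1) auto
  then show ?thesis using head_count_step[of "y - 1"] assms(2) by simp
qed

text \<open>Both sides end a direct letter, and the number of direct letters that end between \<open>c\<^sub>i\<close>
  and them is \<open>n k\<close>, because each \<open>\<eta>\<^sub>j\<close> occurs once as a direct letter in every period.\<close>

lemma next_head_iterate:
  assumes "i \<in> {1..n}"
  shows "(next_head ^^ (n * k)) (eta_head i) = eta_head i + period * int k"
proof -
  have pos: "snd (edge ((next_head ^^ j) (eta_head i) - 1)) = Pos" for j
    using edge_eta_head[OF assms] gap_Pos by (cases j) (simp_all add: next_head_def)
  have "head_count ((next_head ^^ j) (eta_head i)) = head_count (eta_head i) + int j" for j
    by (induction j) (simp_all add: head_count_next)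
  then have eq: "head_count ((next_head ^^ (n * k)) (eta_head i)) = head_count (eta_head i + period * int k)"
    by (simp add: head_count_period)
  have "snd (edge (eta_head i + period * int k - 1)) = Pos"
    using edge_period[of "eta_head i + period * int k - 1" "eta_head i - 1"] edge_eta_head[OF assms] by simp
  then show ?thesis
    using head_count_strict[of "(next_head ^^ (n * k)) (eta_head i)" "eta_head i + period * int k"]
      head_count_strict[of "eta_head i + period * int k" "(next_head ^^ (n * k)) (eta_head i)"]
      pos[of "n * k"] eq by (metis less_irrefl linorder_less_linear)
qed

lemma similar_letter_Neg:
  assumes "similar_letter u (edge x)" "snd u = Neg"
  shows "u = edge x"
proof (rule ccontr)
  assume "u \<noteq> edge x"
  then obtain i where "fst u = Eps i" "edge x = letter_inv u" using assms(1) by (auto simp: similar_letter_def)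
  then have "fst (edge x) = Eps i" "snd (edge x) = Pos" using assms(2) by (simp_all add: letter_inv_def)
  then show False using edge_Eps_Neg[of x i] by simp
qed

lemma eta_head_walk_0:
  assumes "i \<in> {1..n}"
  shows "walk (eta_head i) 0 = (if (i - 1, i) \<in> \<Omega> then Triv i Pos else Triv (i - 1) Neg)"
proof (cases "(i - 1, i) \<in> \<Omega>")
  case True
  have "int i mod period = int i" using assms period_pos by simp
  then show ?thesis using True vert_up[of i 0] assms by (simp add: walk_0 eta_head_def)
next
  case False
  have "(- int i) mod period = period - int i"
    using mod_period_eqI[of "- int i" "- 1" "period - int i"] assms period_pos by simp
  moreover have "i - 1 \<le> n" using assms by auto
  from vert_down[OF this, of 0] have "vert (- int i) = i - 1" using assms by (simp add: of_nat_diff)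
  ultimately show ?thesis using False assms period_pos by (simp add: walk_0 eta_head_def)
qed

text \<open>An inverse string that can follow \<open>\<eta>\<^sub>i\<close> must read the letters from \<open>c\<^sub>i\<close> on, with loops
  inverse, so it is \<open>walk c\<^sub>i l\<close> with \<open>l\<close> at most the gap. Hence the longest one exists and is unique. If the gap is
  \<open>0\<close>, no loop lies next to \<open>c\<^sub>i\<close>, so the trivial string lies over an inner vertex and
  its sign fits.\<close>

lemma r_string_walk:
  assumes i: "i \<in> {1..n}"
  shows "r_string n \<Omega> i = walk (eta_head i) (gap (eta_head i))"
proof -
  let ?c = "eta_head i"
  let ?P = "\<lambda>r. is_string n \<Omega> r \<and> inverse_string r \<and> composable n \<Omega> (eta i Pos) r"
  have eta: "edge (?c - 1) = (Eta i, Pos)" by (rule edge_eta_head[OF i])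
  have vc: "lsrc \<Omega> (Eta i, Pos) = vert ?c" using vert_edge(2)[of "?c - 1"] by (simp add: eta)
  have cand: "r = walk ?c (str_length r) \<and> str_length r \<le> gap ?c" if r: "?P r" for r
  proof (cases r)
    case (Triv j \<sigma>)
    then have "composable n \<Omega> (eta i Pos) (Triv j \<sigma>)" using r by blast
    then have *: "1 \<le> j" "lsrc \<Omega> (last [(Eta i, Pos)]) = j"
      "fst (last [(Eta i, Pos)]) = Eta (case \<sigma> of Pos \<Rightarrow> j | Neg \<Rightarrow> j + 1)"
      unfolding eta_def composable.simps by blast+
    have j: "i = (case \<sigma> of Pos \<Rightarrow> j | Neg \<Rightarrow> j + 1)" using *(3) by simp
    have "vert ?c = j" using *(2) vc by simp
    have "r = walk ?c 0"
      using j *(1) \<open>vert ?c = j\<close> Triv eta_head_walk_0[OF i] by (cases \<sigma>) (auto simp: walk_0 split: if_splits)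
    then show ?thesis by (simp add: str_length_walk)
  next
    case (Word ws)
    have ne: "ws \<noteq> []" and lk: "linkable \<Omega> (edge (?c - 1)) (hd ws)" using r Word by (simp_all add: eta_def eta)
    have neg: "snd (ws ! j) = Neg" if "j < length ws" for j using r Word that by simp
    have "fst (hd ws) \<in> arrows n" using r Word ne by simp
    then obtain y where y: "similar_letter (hd ws) (edge y)" using letter_position by blast
    have "period dvd y - ?c" using linkable_edge_iff[OF similar_letter_refl y] lk by simp
    then have "edge y = edge ?c" by (rule edge_period)
    then have s: "similar (Word ws) (walk ?c (length ws))"
      using word_similar_walk[of ws ?c] y r Word by simp
    have eq: "ws ! j = edge (?c + int j)" if "j < length ws" for j
      using s ne neg[OF that] that
      by (intro similar_letter_Neg) (auto simp: walk_pos list_all2_conv_all_nth)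
    then have "ws = map (\<lambda>j. edge (?c + int j)) [0..<length ws]" by (intro nth_equalityI) auto
    then have "r = walk ?c (length ws)" using Word ne by (simp add: walk_pos)
    moreover have "length ws \<le> gap ?c"
    proof (rule ccontr)
      assume "\<not> length ws \<le> gap ?c"
      then show False using eq[of "gap ?c"] neg[of "gap ?c"] gap_Pos[of ?c] by simp
    qed
    ultimately show ?thesis by (simp add: str_length_walk)
  qed
  have "composable n \<Omega> (eta i Pos) (walk ?c (gap ?c))"
  proof (cases "gap ?c = 0")
    case True
    then have "\<not> cut (?c + 1)" using gap_Pos[of ?c] snd_edge_Pos_not_cut[of ?c] by simp
    then have "vert ?c \<notin> {0, n}" using vert_0_or_n[of ?c] eta_head_not_cut[OF i] by simp
    then have "1 \<le> vert ?c" "vert ?c < n" using vert_le[of ?c] by auto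
    then show ?thesis
      using True eta_head_walk_0[OF i] vc i by (auto simp: eta_def walk_0 split: if_splits)
  next
    case False
    then show ?thesis
      using linkable_edge_iff[of "edge (?c - 1)" "?c - 1" "edge ?c" ?c]
      by (simp add: eta_def walk_pos hd_map eta similar_letter_refl)
  qed
  moreover have "inverse_string (walk ?c (gap ?c))"
    using gap_Neg[of _ ?c] by (cases "gap ?c = 0") (auto simp: walk_def)
  ultimately have P: "?P (walk ?c (gap ?c))" using is_string_walk by blast
  show ?thesis
    unfolding r_string_def
  proof (rule the_equality)
    show "?P (walk ?c (gap ?c)) \<and> (\<forall>r'. ?P r' \<longrightarrow> str_length r' \<le> str_length (walk ?c (gap ?c)))" 
      using P cand by (simp add: str_length_walk)
  next
    fix r assume r: "?P r \<and> (\<forall>r'. ?P r' \<longrightarrow> str_length r' \<le> str_length r)"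
    then have "gap ?c \<le> str_length r" using P str_length_walk by metis
    then have "str_length r = gap ?c" "r = walk ?c (str_length r)" using cand[of r] r by auto
    then show "r = walk ?c (gap ?c)" by (simp only:)
  qed
qed

text \<open>For a nonempty walk this is \<open>linkable_edge_iff\<close>. For a trivial one, the vertex is an inner
  one since the walk is locally free, and the sign of the trivial string selects the direction.\<close>

lemma composable_walk_eta:
  assumes "\<not> cut p" "\<not> cut (p + int l + 1)" "k \<in> {1..n}"
  shows "composable n \<Omega> (walk p l) (eta k \<sigma>) \<longleftrightarrow> edge (p + int l) = (Eta k, \<sigma>)"
proof (cases "l = 0")
  case False
  let ?e = "p + int (l - 1)"
  have e: "?e + 1 = p + int l" using False by simp
  obtain y where y: "similar_letter (Eta k, \<sigma>) (edge y)"
    using letter_position[of "(Eta k, \<sigma>)"] assms(3) by (auto simp: arrows_def)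
  then have y': "(Eta k, \<sigma>) = edge y" by (auto simp: similar_letter_def)
  have "composable n \<Omega> (walk p l) (eta k \<sigma>) \<longleftrightarrow> linkable \<Omega> (edge ?e) (Eta k, \<sigma>)"
    using False by (simp add: walk_pos eta_def last_map)
  also have "\<dots> \<longleftrightarrow> period dvd y - (p + int l)"
    using linkable_edge_iff[OF similar_letter_refl y, of ?e] e by simp
  also have "\<dots> \<longleftrightarrow> edge (p + int l) = (Eta k, \<sigma>)"
    unfolding y' using edge_period similar_edge_iff similar_letter_refl by metis
  finally show ?thesis .
next
  case True
  then have c1: "\<not> cut (p + 1)" using assms(2) by simp
  then have v: "vert p \<notin> {0, n}" using vert_0_or_n[of p] assms(1) by simp
  have v1: "1 \<le> vert p" "vert p < n" using v vert_le[of p] by auto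
  have comp: "composable n \<Omega> (walk p 0) (eta k \<sigma>) \<longleftrightarrow>
     ltgt \<Omega> (Eta k, \<sigma>) = vert p \<and> k = (if p mod period \<le> int n then vert p + 1 else vert p)"
    using v1 by (auto simp: walk_0 eta_def)
  show ?thesis
  proof (cases p rule: edge_position_cases)
    case (up m j)
    have p: "p = period * m + int (j - 1)" using up by (simp add: of_nat_diff)
    have "vert p = j - 1" unfolding p using up(1) by (intro vert_up) auto
    moreover have "p mod period = int (j - 1)"
      using up(1) period_pos by (intro mod_period_eqI[OF p]) auto
    moreover have "edge p = (Eta j, if (j - 1, j) \<in> \<Omega> then Pos else Neg)"
      unfolding up(2) by (rule edge_up[OF up(1)])
    ultimately show ?thesis
      using up(1) True comp by (cases \<sigma>) (auto simp: ltgt_def)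
  next
    case (down m j)
    have "vert p = j" unfolding down(2) using down(1) by (intro vert_down) auto
    moreover have "p mod period = period - int j - 1"
      using down period_pos by (intro mod_period_eqI[of _ "m - 1"]) (auto simp: right_diff_distrib)
    moreover have "edge p = (Eta j, if (j - 1, j) \<in> \<Omega> then Neg else Pos)"
      unfolding down(2) by (rule edge_down[OF down(1)])
    ultimately show ?thesis
      using down(1) True comp v1 period_pos by (cases \<sigma>) (auto simp: ltgt_def)
  next
    case (top m)
    then show ?thesis using c1 edge_Eps(1)[of p] edge_top[of m] by simp
  next
    case (bottom m)
    then show ?thesis using c1 edge_Eps(1)[of p] edge_bottom[of m] by simp
  qed
qed

lemma str_concat_walk:
  assumes "l > 0 \<or> m > 0"
  shows "str_concat (walk p l) (walk (p + int l) m) = walk p (l + m)"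
proof -
  have *: "map f [0..<l] @ map (\<lambda>j. f (l + j)) [0..<m] = map f [0..<l + m]" for f :: "nat \<Rightarrow> letter"
    by (induction m) simp_all
  show ?thesis
  proof (cases "l = 0 \<or> m = 0")
    case True
    then show ?thesis using assms by (auto simp: walk_def)
  next
    case False
    then show ?thesis
      using *[of "\<lambda>j. edge (p + int j)"] by (simp add: walk_pos add.assoc)
  qed
qed

lemma shift_walk:
  assumes "\<not> cut p" "snd (edge (p + int l)) = Pos"
  shows "shift n \<Omega> (walk p l) = walk p (l + 1 + gap (p + int l + 1))"
proof -
  let ?e = "p + int l + 1"
  have ce: "\<not> cut ?e" by (rule snd_edge_Pos_not_cut[OF assms(2)])
  obtain i where i: "i \<in> {1..n}" "period dvd ?e - eta_head i"
    using snd_edge_Pos[of ?e] assms(2) by auto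
  then have edge: "edge (p + int l) = (Eta i, Pos)" using edge_Pos_iff[of ?e i] by simp
  have "next_eta n \<Omega> (walk p l) = (i, Pos)"
    unfolding next_eta_def
  proof (rule the_equality)
    show "fst (i, Pos) \<in> {1..n} \<and> composable n \<Omega> (walk p l) (eta (fst (i, Pos)) (snd (i, Pos)))"
      using i(1) edge composable_walk_eta[OF assms(1) ce i(1)] by simp
  next
    fix q assume q: "fst q \<in> {1..n} \<and> composable n \<Omega> (walk p l) (eta (fst q) (snd q))"
    then show "q = (i, Pos)"
      using edge composable_walk_eta[OF assms(1) ce, of "fst q" "snd q"] by (simp add: prod_eq_iff)
  qed
  moreover have "eta i Pos = walk (p + int l) 1" using edge by (simp add: eta_def walk_pos)
  moreover have "r_string n \<Omega> i = walk (p + int (l + 1)) (gap ?e)"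
    using r_string_walk[OF i(1)] walk_period[OF i(2)] gap_period[OF i(2)] by (simp add: add_ac)
  ultimately show ?thesis
    using str_concat_walk[of l 1 p] str_concat_walk[of "l + 1" "gap ?e" p] by (simp add: shift_def)
qed

text \<open>The shift of a walk moves the position behind it from one end of a direct letter to the next
  one.\<close>

lemma shift_iter_walk:
  assumes "\<not> cut p" "snd (edge (p + int l)) = Pos"
  shows "shift_iter n \<Omega> (walk p l) j = walk p (nat ((next_head ^^ j) (p + int l + 1) - p - 1))"
proof -
  have "shift_iter n \<Omega> (walk p l) j = walk p (nat ((next_head ^^ j) (p + int l + 1) - p - 1))
      \<and> p < (next_head ^^ j) (p + int l + 1) \<and> snd (edge ((next_head ^^ j) (p + int l + 1) - 1)) = Pos"
  proof (induction j)
    case 0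
    then show ?case using assms(2) by (simp add: shift_iter_def)
  next
    case (Suc j)
    define y where "y = (next_head ^^ j) (p + int l + 1)"
    define l' where "l' = nat (y - p - 1)"
    have IH: "shift_iter n \<Omega> (walk p l) j = walk p l'" "p < y" "snd (edge (y - 1)) = Pos"
      using Suc.IH by (simp_all add: y_def l'_def)
    have l': "y = p + int l' + 1" using IH(2) by (simp add: l'_def)
    have "shift n \<Omega> (walk p l') = walk p (l' + 1 + gap y)"
      using shift_walk[OF assms(1), of l'] IH(3) l' by simp
    moreover have "l' + 1 + gap y = nat (next_head y - p - 1)"
      using l' by (simp add: next_head_def)
    moreover have "p < next_head y" "snd (edge (next_head y - 1)) = Pos"
      using IH(2) gap_Pos[of y] by (simp_all add: next_head_def)
    ultimately show ?case using IH(1) by (simp add: shift_iter_def y_def)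
  qed
  then show ?thesis by blast
qed

text \<open>The string \<open>r\<^sub>i\<close> itself accounts for one step of \<open>next_head\<close>, so \<open>n k - 1\<close> shifts lead to the
  iterate \<open>n k\<close>.\<close>

lemma shift_iter_r_string:
  assumes i: "i \<in> {1..n}" and k: "k \<ge> 1"
  shows "shift_iter n \<Omega> (r_string n \<Omega> i) (n * k - 1) = walk (eta_head i) (nat (period * int k - 1))"
proof -
  have "(next_head ^^ (n * k - 1)) (next_head (eta_head i)) = (next_head ^^ (n * k)) (eta_head i)"
    using k n2 by (cases "n * k") (simp_all add: funpow_swap1)
  also have "\<dots> = eta_head i + period * int k" by (rule next_head_iterate[OF i])
  finally show ?thesis
    using shift_iter_walk[OF eta_head_not_cut[OF i] gap_Pos[of "eta_head i"], of "n * k - 1"]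
    by (simp add: r_string_walk[OF i] next_head_def)
qed

lemma sim_class_shift_iter:
  assumes i: "i \<in> {1..n}" and k: "k \<ge> 1"
  shows "sim_class n \<Omega> (shift_iter n \<Omega> (r_string n \<Omega> i) (n * k - 1))
      = sim_class n \<Omega> (walk (eta_head i) (nat (period * int k - 1)))"
    "sim_class n \<Omega> (str_inv (shift_iter n \<Omega> (r_string n \<Omega> i) (n * k - 1)))
      = sim_class n \<Omega> (walk (- eta_head i) (nat (period * int k - 1)))"
proof -
  let ?l = "nat (period * int k - 1)"
  have pk: "period * int k \<ge> 1" using k period_pos by (simp add: int_one_le_iff_zero_less)
  then have "walk (- (eta_head i + int ?l + 1)) ?l = walk (- eta_head i) ?l"
    by (intro walk_period) simp
  then show "sim_class n \<Omega> (str_inv (shift_iter n \<Omega> (r_string n \<Omega> i) (n * k - 1)))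
      = sim_class n \<Omega> (walk (- eta_head i) ?l)"
    using sim_class_similar[OF str_inv_walk[of "eta_head i" ?l]] by (simp only: shift_iter_r_string[OF i k])
qed (simp only: shift_iter_r_string[OF i k])

end

section \<open>The image and the fibres of the rank function\<close>

theorem theorem3p7:
  fixes n :: nat and \<Omega> :: "(nat \<times> nat) set"
  assumes n: "n \<ge> 2" and \<Omega>: "orientation n \<Omega>"
  shows "rk n \<Omega> ` St_lf n \<Omega> = pos_roots n
    \<and> (\<forall>w \<in> St_lf n \<Omega>. rk n \<Omega> w \<in> pos_real_roots n \<longrightarrow>
         {v \<in> St_lf n \<Omega>. rk n \<Omega> v = rk n \<Omega> w}
           = sim_class n \<Omega> w \<union> sim_class n \<Omega> (str_inv w)
         \<and> (sim_class n \<Omega> w = sim_class n \<Omega> (str_inv w) \<longleftrightarrow> long_root n (rk n \<Omega> w)))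
    \<and> (\<forall>w \<in> St_lf n \<Omega>. rk n \<Omega> w \<in> pos_imag_roots n \<longrightarrow>
         (\<exists>k::nat. k \<ge> 1 \<and>
           (let R = (\<lambda>i. shift_iter n \<Omega> (r_string n \<Omega> i) (n * k - 1));
                A = (\<lambda>i. sim_class n \<Omega> (R i));
                B = (\<lambda>i. sim_class n \<Omega> (str_inv (R i)))
            in {v \<in> St_lf n \<Omega>. rk n \<Omega> v = rk n \<Omega> w} = (\<Union>i\<in>{1..n}. A i \<union> B i)
               \<and> (\<forall>i\<in>{1..n}. A i \<inter> B i = {})
               \<and> disjoint_family_on (\<lambda>i. A i \<union> B i) {1..n})))"
proof -
  interpret walks n \<Omega> by unfold_locales (rule n)
  show ?thesis
  proof (intro conjI ballI impI)
    show "rk n \<Omega> ` St_lf n \<Omega> = pos_roots n" by (rule rank_image)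
  next
    fix w assume w: "w \<in> St_lf n \<Omega>" "rk n \<Omega> w \<in> pos_real_roots n"
    show "{v \<in> St_lf n \<Omega>. rk n \<Omega> v = rk n \<Omega> w} = sim_class n \<Omega> w \<union> sim_class n \<Omega> (str_inv w)"
      "sim_class n \<Omega> w = sim_class n \<Omega> (str_inv w) \<longleftrightarrow> long_root n (rk n \<Omega> w)"
      by (rule real_fibre[OF w])+
  next
    fix w assume w: "w \<in> St_lf n \<Omega>" "rk n \<Omega> w \<in> pos_imag_roots n"
    then obtain k' :: int where k': "k' \<ge> 1" "rk n \<Omega> w = (\<lambda>j. k' * rho n j)"
      by (auto simp: pos_imag_roots_def)
    define k where "k = nat k'"
    have k: "k \<ge> 1" and rk: "rk n \<Omega> w = (\<lambda>j. int k * rho n j)" using k' by (simp_all add: k_def)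
    define A where "A i = sim_class n \<Omega> (shift_iter n \<Omega> (r_string n \<Omega> i) (n * k - 1))" for i
    define B where "B i = sim_class n \<Omega> (str_inv (shift_iter n \<Omega> (r_string n \<Omega> i) (n * k - 1)))" for i
    let ?l = "nat (period * int k - 1)"
    have A: "A i = sim_class n \<Omega> (walk (eta_head i) ?l)" and B: "B i = sim_class n \<Omega> (walk (- eta_head i) ?l)"
      if "i \<in> {1..n}" for i
      using sim_class_shift_iter[OF that k] by (simp_all add: A_def B_def)
    have AA: "A i \<inter> A j = {}" "B i \<inter> B j = {}" if "i \<in> {1..n}" "j \<in> {1..n}" "i \<noteq> j" for i j
    proof -
      have nd: "\<not> period dvd eta_head i - eta_head j" "\<not> period dvd - eta_head i - - eta_head j"
        using eta_head_distinct(1)[OF that(1,2)] eta_head_distinct(1)[OF that(2,1)] that(3) by auto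
      show "A i \<inter> A j = {}" "B i \<inter> B j = {}"
        unfolding A[OF that(1)] A[OF that(2)] B[OF that(1)] B[OF that(2)]
        by (rule sim_class_walk_disjoint[OF nd(1)]) (rule sim_class_walk_disjoint[OF nd(2)])
    qed
    have AB: "A i \<inter> B j = {}" if "i \<in> {1..n}" "j \<in> {1..n}" for i j
      unfolding A[OF that(1)] B[OF that(2)]
      by (rule sim_class_walk_disjoint) (use eta_head_distinct(2)[OF that] in simp)
    have "{v \<in> St_lf n \<Omega>. rk n \<Omega> v = rk n \<Omega> w} = (\<Union>i\<in>{1..n}. A i \<union> B i)"
      unfolding rk imaginary_fibre[OF k] by (intro SUP_cong) (simp_all add: A B)
    moreover have "\<forall>i\<in>{1..n}. A i \<inter> B i = {}" using AB by blast
    moreover have "disjoint_family_on (\<lambda>i. A i \<union> B i) {1..n}"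
      unfolding disjoint_family_on_def
    proof (intro ballI impI)
      fix i j assume ij: "i \<in> {1..n}" "j \<in> {1..n}" "i \<noteq> j"
      show "(A i \<union> B i) \<inter> (A j \<union> B j) = {}"
        using AA[OF ij] AB[OF ij(1,2)] AB[OF ij(2,1)] by blast
    qed
    ultimately show "\<exists>k::nat. k \<ge> 1 \<and>
           (let R = (\<lambda>i. shift_iter n \<Omega> (r_string n \<Omega> i) (n * k - 1));
                A = (\<lambda>i. sim_class n \<Omega> (R i));
                B = (\<lambda>i. sim_class n \<Omega> (str_inv (R i)))
            in {v \<in> St_lf n \<Omega>. rk n \<Omega> v = rk n \<Omega> w} = (\<Union>i\<in>{1..n}. A i \<union> B i)
               \<and> (\<forall>i\<in>{1..n}. A i \<inter> B i = {})
               \<and> disjoint_family_on (\<lambda>i. A i \<union> B i) {1..n})"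
      using k unfolding Let_def A_def B_def by blast
  qed
qed

end
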